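(* Let $\mathrm{d}=(d_1,\dots,d_n)$ be any degree sequence and let $\mathrm{T}_{\mathrm{d}}$ be a uniformly random element of $\mathcal{T}_{\mathrm{d}}$. Let $n^+=n$ if $n_1(\mathrm{d})\ge 1$ or $n$ is odd, and let $n^+=n+1$ if $n_1(\mathrm{d})=0$ and $n$ is even. Then there is a sub-binary degree sequence $\mathrm{b}=(b_1,\dots,b_{n^+})$ with $n_1(\mathrm{b})\le n_1(\mathrm{d})$ such that, with $\mathrm{T}_{\mathrm{b}}$ a uniformly random element of $\mathcal{T}_{\mathrm{b}}$, $\mathrm{ht}(\mathrm{T}_{\mathrm{d}})\preceq_{\mathrm{st}}\mathrm{ht}(\mathrm{T}_{\mathrm{b}})$.
   Context: A degree sequence is a finite sequence of non-negative integers $\mathrm{d}=(d_1,\dots,d_n)$ with $\sum_{i=1}^n d_i=n-1$. $n_i(\mathrm{d})=|\{j:d_j=i\}|$. A degree sequence $\mathrm{d}$ is sub-binary if $n_i(\mathrm{d})=0$ for all $i\ge 3$. $\mathcal{T}_{\mathrm{d}}$ is the set of rooted labeled trees with vertex set $[n]=\{1,\dots,n\}$ in which, for each $i$, vertex $i$ has exactly $d_i$ children. The height $\mathrm{ht}$ of a rooted tree is the maximum graph distance from the root to a vertex. For random variables $X,Y$, $X\preceq_{\mathrm{st}}Y$ means $\mathbf{P}(X\le t)\ge\mathbf{P}(Y\le t)$ for all $t\in\mathbb{R}$. *)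

theory Defs
  imports
    "HOL-Probability.Probability"
    "Graph_Theory.Pair_Digraph"
    "Graph_Theory.Digraph_Component"
    "Graph_Theory.Shortest_Path"
begin

text \<open>
  As usual in the graph library, an undirected simple graph is a finite symmetric loop-free
  digraph without parallel arcs (\<^locale>\<open>pair_graph\<close>): the edge between \<open>u\<close> and \<open>v\<close> is the
  pair of arcs \<open>(u, v)\<close> and \<open>(v, u)\<close>.  The library predicate \<open>Digraph_Component.tree\<close> is not
  the notion of an undirected tree in this encoding, because it counts \<open>u, v, u\<close> as a cycle.
  Cycles of length at least 3 are exactly the cycles of the undirected graph.  (The name
  \<open>connected\<close> is qualified to distinguish it from topological connectedness.)
\<close>

definition undirected_tree :: "'a pair_pre_digraph \<Rightarrow> bool" where
  "undirected_tree G \<longleftrightarrow>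
     pair_graph G \<and>
     Digraph_Component.connected (with_proj G) \<and>
     \<not> (\<exists>p. pre_digraph.cycle (with_proj G) p \<and> 3 \<le> length p)"

definition graph_dist :: "'a pair_pre_digraph \<Rightarrow> 'a \<Rightarrow> 'a \<Rightarrow> nat" where
  "graph_dist G u v = (LEAST k. \<exists>p. pre_digraph.awalk (with_proj G) u p v \<and> length p = k)"

lemma graph_dist_eq_mu:
  assumes "pair_wf_digraph G" and "u \<rightarrow>\<^sup>*\<^bsub>with_proj G\<^esub> v"
  shows "ereal (real (graph_dist G u v)) = wf_digraph.\<mu> (with_proj G) (\<lambda>_. 1) u v"
proof -
  interpret pair_wf_digraph G by fact
  have cost: "awalk_cost (\<lambda>_. 1) p = real (length p)" for p
    by (induction p) auto
  from assms(2) have ex: "\<exists>k p. awalk u p v \<and> length p = k"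
    by (auto simp: reachable_awalk)
  obtain p where p: "awalk u p v" "length p = graph_dist G u v"
    using LeastI_ex[OF ex] unfolding graph_dist_def by blast
  have le: "graph_dist G u v \<le> length q" if "awalk u q v" for q
    unfolding graph_dist_def using that by (intro Least_le) blast
  show ?thesis
    unfolding \<mu>_def cost
  proof (rule antisym)
    show "ereal (real (graph_dist G u v)) \<le> (INF q\<in>{q. awalk u q v}. ereal (real (length q)))"
      by (rule INF_greatest) (use le in auto)
    show "(INF q\<in>{q. awalk u q v}. ereal (real (length q))) \<le> ereal (real (graph_dist G u v))"
      by (rule INF_lower2[of p]) (use p in auto)
  qed
qed

text \<open>In a pair \<open>(r, G)\<close>, the first component is the root.\<close>

type_synonym 'a rooted_tree = "'a \<times> 'a pair_pre_digraph"

definition is_rooted_tree :: "'a rooted_tree \<Rightarrow> bool" where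
  "is_rooted_tree T \<longleftrightarrow> undirected_tree (snd T) \<and> fst T \<in> pverts (snd T)"

text \<open>
  In a tree, neighbours differ by exactly 1 in their distance from the root, so the condition on
  distances excludes precisely the parent of \<open>v\<close>.
\<close>

definition children :: "'a rooted_tree \<Rightarrow> 'a \<Rightarrow> 'a set" where
  "children T v =
     {w. (v, w) \<in> parcs (snd T) \<and>
         graph_dist (snd T) (fst T) w = graph_dist (snd T) (fst T) v + 1}"

definition tree_height :: "'a rooted_tree \<Rightarrow> nat" where
  "tree_height T = Max (graph_dist (snd T) (fst T) ` pverts (snd T))"

text \<open>
  Degree sequences are lists, so the term \<open>d\<^sub>i\<close> of the sequence, for \<open>1 \<le> i \<le> n\<close>, is
  \<open>d ! (i - 1)\<close>.  The condition on the sum is written without truncated subtraction; in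
  particular it forces the sequence to be nonempty.
\<close>

definition degree_sequence :: "nat list \<Rightarrow> bool" where
  "degree_sequence d \<longleftrightarrow> sum_list d + 1 = length d"

definition num_degree :: "nat \<Rightarrow> nat list \<Rightarrow> nat" where
  "num_degree i d = card {j \<in> {1..length d}. d ! (j - 1) = i}"

definition sub_binary :: "nat list \<Rightarrow> bool" where
  "sub_binary d \<longleftrightarrow> (\<forall>i\<ge>3. num_degree i d = 0)"

definition trees_of :: "nat list \<Rightarrow> nat rooted_tree set" where
  "trees_of d =
     {T. is_rooted_tree T \<and> pverts (snd T) = {1..length d} \<and>
         (\<forall>i\<in>{1..length d}. card (children T i) = d ! (i - 1))}"

lemma finite_trees_of: "finite (trees_of d)"
proof -
  let ?V = "{1..length d}"
  let ?f = "\<lambda>(r, A). (r, \<lparr>pverts = ?V, parcs = A\<rparr>)"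
  have "trees_of d \<subseteq> ?f ` (?V \<times> Pow (?V \<times> ?V))"
  proof
    fix T assume T: "T \<in> trees_of d"
    obtain r G where rG: "T = (r, G)" by (cases T)
    from T rG have G: "pair_graph G" "pverts G = ?V" "r \<in> ?V"
      by (auto simp: trees_of_def is_rooted_tree_def undirected_tree_def)
    interpret pair_graph G by fact
    have "parcs G \<subseteq> ?V \<times> ?V"
      using G(2) by (auto dest: in_arcsD1 in_arcsD2)
    moreover have "G = \<lparr>pverts = ?V, parcs = parcs G\<rparr>"
      using G(2) by (cases G) auto
    ultimately show "T \<in> ?f ` (?V \<times> Pow (?V \<times> ?V))"
      using G(3) rG by (intro image_eqI[of _ _ "(r, parcs G)"]) auto
  qed
  then show ?thesis
    by (rule finite_subset) auto
qed

definition uniform_tree :: "nat list \<Rightarrow> nat rooted_tree pmf" where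
  "uniform_tree d = pmf_of_set (trees_of d)"

definition stoch_le ::
    "'a measure \<Rightarrow> ('a \<Rightarrow> real) \<Rightarrow> 'b measure \<Rightarrow> ('b \<Rightarrow> real) \<Rightarrow> bool" where
  "stoch_le M X N Y \<longleftrightarrow>
     (\<forall>t. measure N {y \<in> space N. Y y \<le> t} \<le> measure M {x \<in> space M. X x \<le> t})"

definition n_plus :: "nat list \<Rightarrow> nat" where
  "n_plus d = (if num_degree 1 d \<ge> 1 \<or> odd (length d) then length d else length d + 1)"

end

theory Submission
  imports Defs
begin

text \<open>
  Let \<open>u\<close> and \<open>v\<close> have \<open>a\<close> and \<open>b\<close> children, where \<open>b < a\<close>. Moving one child from \<open>u\<close> to \<open>v\<close>
  makes the height stochastically larger. To see this, count the trees in which the degrees of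
  \<open>u\<close> and \<open>v\<close> are \<open>a, b\<close> in either order, and group them by what remains when the \<open>a + b\<close> children
  of \<open>u\<close> and \<open>v\<close> are cut off. Within a group, let \<open>k\<close> be the number of those children that may hang
  below the lower one of \<open>u\<close> and \<open>v\<close>: a child may not if its subtree is too high, or if it is the
  ancestor of the lower vertex. Then exactly \<open>(k choose a) + (k choose b)\<close> trees of the group satisfy
  the height bound, or none, and the claim becomes an inequality between binomial coefficients.
  Without a height bound \<open>k\<close> is \<open>a + b\<close> or \<open>a + b - 1\<close> and equality holds, which gives the ratio
  of the total numbers of trees without enumerating them.

  Such moves turn any degree sequence into a sub-binary one. If \<open>n\<^sub>1(d) = 0\<close> and \<open>n\<close> is even, a
  vertex of degree 1 is first inserted on an edge (or above the root), which never lowers the height.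
\<close>

section \<open>Forests with cut-off vertices\<close>

lemma binomial_step: "(j + 1) * (k choose (j + 1)) = (k - j) * (k choose j)" for j k :: nat
  using times_binomial_minus1_eq[of "j + 1" k] binomial_absorb_comp[of k j] by simp

text \<open>Absorbing the factors \<open>b + 1\<close> and \<open>a\<close> leaves only X = (k
  choose b) and Y = (k choose (a - 1)). For \<open>a - 1 \<le> k\<close>, right side minus left side
  is (a + b - k)(X - Y). Here X is at least Y by unimodality when \<open>k < a + b\<close>; the
  product vanishes for k = a + b, and by symmetry (X = Y) for k = a + b - 1.\<close>

lemma binomial_transfer:
  fixes a b k :: nat
  assumes "b < a" "k \<le> a + b"
  shows "(b + 1) * ((k choose (b + 1)) + (k choose (a - 1))) \<le> a * ((k choose b) + (k choose a))"
    and "a + b \<le> k + 1 \<Longrightarrow>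
      (b + 1) * ((k choose (b + 1)) + (k choose (a - 1))) = a * ((k choose b) + (k choose a))"
proof -
  define X Y where "X = (k choose b)" and "Y = (k choose (a - 1))"
  have eq: "X = Y" if "k + 1 = a + b"
  proof -
    have "k - b = a - 1" "b \<le> k" using that assms by auto
    then show ?thesis using binomial_symmetric[of b k] by (simp add: X_def Y_def)
  qed
  \<comment> \<open>\<open>b\<close> is at least as close to the middle \<open>k / 2\<close> as
    \<open>a - 1\<close>: either both lie beyond the middle, or the reflection
    \<open>k - (a - 1)\<close> is at most \<open>b\<close>.\<close>
  have le: "Y \<le> X" if "k < a + b" "a - 1 \<le> k"
  proof (cases "2 * b \<ge> k")
    case True
    then show ?thesis unfolding X_def Y_def using assms that by (intro binomial_antimono) auto
  next
    case False
    have "Y = (k choose (k - (a - 1)))"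
      using that unfolding Y_def by (intro binomial_symmetric)
    also have "\<dots> \<le> X"
      using assms that False unfolding X_def by (intro binomial_mono) auto
    finally show ?thesis .
  qed
  have Y0: "Y = 0" if "k < a - 1"
    using that by (simp add: Y_def)
  have b: "(b + 1) * (k choose (b + 1)) = (k - b) * X"
    by (simp only: X_def binomial_step)
  have a: "a * (k choose a) = (k - (a - 1)) * Y"
    using binomial_step[of "a - 1" k] assms(1) by (simp add: Y_def)
  have L: "(b + 1) * ((k choose (b + 1)) + (k choose (a - 1))) = (k - b) * X + (b + 1) * Y"
    by (simp only: distrib_left b Y_def)
  have R: "a * ((k choose b) + (k choose a)) = a * X + (k - (a - 1)) * Y"
    by (simp only: distrib_left a X_def)
  have "(k - b) * X + (b + 1) * Y \<le> a * X + (k - (a - 1)) * Y"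
  \<comment> \<open>Below \<open>a - 1\<close> the subtraction truncates and the formula for the
    difference fails, but then \<open>Y\<close> vanishes.\<close>
  proof (cases "k < a - 1")
    case True
    then have "(k - b) * X \<le> a * X" by (intro mult_right_mono) auto
    with Y0[OF True] show ?thesis by simp
  next
    case False
    define m where "m = a + b - k"
    have "m * Y \<le> m * X"
      using le False by (cases "m = 0") (auto simp: m_def)
    moreover have "a = (k - b) + m" "b + 1 = (k - (a - 1)) + m"
      using False assms by (auto simp: m_def)
    moreover have "p * X + B * Y \<le> A * X + q * Y"
      if "m * Y \<le> m * X" "A = p + m" "B = q + m" for p q A B
      using that by (simp add: algebra_simps)
    ultimately show ?thesis by blast
  qed
  then show "(b + 1) * ((k choose (b + 1)) + (k choose (a - 1))) \<le> a * ((k choose b) + (k choose a))"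
    by (simp only: L R)
  assume ab: "a + b \<le> k + 1"
  have "(k - b) * X + (b + 1) * Y = a * X + (k - (a - 1)) * Y"
  proof (cases "k = a + b")
    case True
    then show ?thesis using assms by simp
  next
    case False
    with ab assms have "k + 1 = a + b" by simp
    moreover have "k - b = a - 1" "k - (a - 1) = b" "a = (a - 1) + 1"
      using calculation assms by auto
    ultimately show ?thesis using eq assms(1) by (cases a) auto
  qed
  then show "(b + 1) * ((k choose (b + 1)) + (k choose (a - 1))) = a * ((k choose b) + (k choose a))"
    by (simp only: L R)
qed

text \<open>
  A rooted tree is represented by its parent map; the parent of the root is 0, which is not a
  vertex. Hence \<open>dep f w\<close> is 1 more than the distance of \<open>w\<close> from the root.
\<close>

definition dep :: "('a::zero \<Rightarrow> 'a) \<Rightarrow> 'a \<Rightarrow> enat" where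
  "dep f w = (if \<exists>m. (f ^^ m) w = 0 then enat (LEAST m. (f ^^ m) w = 0) else \<infinity>)"

lemma dep_0 [simp]: "dep f 0 = 0"
proof -
  have "(LEAST m. (f ^^ m) 0 = 0) = 0"
    by (rule Least_equality) auto
  moreover have "\<exists>m. (f ^^ m) 0 = 0" by (rule exI[of _ 0]) simp
  ultimately show ?thesis by (simp add: dep_def zero_enat_def)
qed

lemma dep_step:
  assumes w: "w \<noteq> 0"
  shows "dep f w = eSuc (dep f (f w))"
proof -
  have Suc: "(f ^^ Suc m) w = (f ^^ m) (f w)" for m
    by (simp only: funpow_Suc_right o_apply)
  have ex: "(\<exists>m. (f ^^ m) w = 0) \<longleftrightarrow> (\<exists>m. (f ^^ m) (f w) = 0)"
    (is "?L \<longleftrightarrow> ?R")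
  proof
    assume ?L
    then obtain m where m: "(f ^^ m) w = 0" by blast
    with w obtain k where "m = Suc k" by (cases m) auto
    with m show ?R by (auto simp only: Suc)
  next
    assume ?R
    then show ?L by (metis Suc)
  qed
  show ?thesis
  proof (cases "\<exists>m. (f ^^ m) w = 0")
    case True
    then obtain m where m: "(f ^^ m) w = 0" by blast
    have "(LEAST m. (f ^^ m) w = 0) = Suc (LEAST m. (f ^^ Suc m) w = 0)"
      by (rule Least_Suc[where P = "\<lambda>m. (f ^^ m) w = 0", OF m]) (use w in simp)
    then show ?thesis using True ex
      by (simp only: dep_def Suc if_True eSuc_enat)
  next
    case False
    then show ?thesis using ex by (simp only: dep_def if_False eSuc_infinity)
  qed
qed

lemma dep_eq_0_iff [simp]: "dep f w = 0 \<longleftrightarrow> w = 0"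
  using dep_step[of w f] by (cases "w = 0") auto

lemma dep_cong:
  assumes "\<And>m. (f ^^ m) w = (g ^^ m) w"
  shows "dep f w = dep g w"
  using assms by (simp add: dep_def)

text \<open>\<open>f0\<close> is a forest whose vertices in \<open>W\<close> are cut off from their parents.\<close>

definition attach :: "('a \<Rightarrow> 'a) \<Rightarrow> 'a set \<Rightarrow> 'a \<Rightarrow> 'a \<Rightarrow> 'a set \<Rightarrow> 'a \<Rightarrow> 'a" where
  "attach f0 W u v A w = (if w \<in> A then v else if w \<in> W then u else f0 w)"

text \<open>The ways of hanging the cut-off vertices, \<open>A\<close> below \<open>v\<close> and
  the rest below \<open>u\<close>, that respect the height bound. A cycle gives infinite depth, so
  such attachments are excluded even for \<open>T = \<infinity>\<close>.\<close>

definition shallow :: "('a::zero \<Rightarrow> 'a) \<Rightarrow> 'a set \<Rightarrow> 'a set \<Rightarrow> enat \<Rightarrow> 'a \<Rightarrow> 'a \<Rightarrow> 'a set set" where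
  "shallow f0 W V T u v = {A. A \<subseteq> W \<and> (\<forall>w\<in>V. dep (attach f0 W u v A) w < T)}"

text \<open>For \<open>c\<close> in \<open>W\<close> this says that \<open>w\<close> lies in the
  cut-off subtree with top \<open>c\<close>.\<close>

definition lands :: "('a \<Rightarrow> 'a) \<Rightarrow> 'a \<Rightarrow> 'a \<Rightarrow> bool" where
  "lands f w c \<longleftrightarrow> (\<exists>m. (f ^^ m) w = c)"

section \<open>Depths after attaching the cut-off vertices, and the shape of
  \<open>shallow\<close>\<close>

context
  fixes f0 :: "'a::zero \<Rightarrow> 'a" and W :: "'a set"
  assumes f0_0: "f0 0 = 0" and f0_W: "\<And>c. c \<in> W \<Longrightarrow> f0 c = 0" and W0: "0 \<notin> W"
begin

lemma f0_pow_0: "(f0 ^^ m) 0 = 0"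
  by (induction m) (auto simp: f0_0)

text \<open>The upward walk from \<open>w\<close> agrees with that of \<open>f0\<close> as far as
  \<open>c\<close>, then continues at \<open>v\<close> or \<open>u\<close>. Since \<open>c\<close>
  has parent 0 in \<open>f0\<close>, \<open>dep f0 w\<close> counts exactly the steps up to and
  including the one that leaves \<open>c\<close>. The equation also holds for infinite depths, and
  this is how cycles are detected.\<close>

lemma lands_dep:
  assumes "lands f0 w c" "c \<in> W" "A \<subseteq> W"
  shows "dep (attach f0 W u v A) w
    = dep f0 w + (if c \<in> A then dep (attach f0 W u v A) v else dep (attach f0 W u v A) u)"
proof -
  from assms(1) obtain m where "(f0 ^^ m) w = c" by (auto simp: lands_def)
  then show ?thesis
  proof (induction m arbitrary: w)
    case 0
    then have w: "w = c" by simp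
    with assms W0 have "c \<noteq> 0" by auto
    have "dep (attach f0 W u v A) c = 1 + dep (attach f0 W u v A) (if c \<in> A then v else u)"
      using dep_step[OF \<open>c \<noteq> 0\<close>, of "attach f0 W u v A"] assms(2)
      by (simp only: attach_def plus_1_eSuc if_True)
    moreover have "dep f0 c = 1"
      using dep_step[OF \<open>c \<noteq> 0\<close>, of f0] f0_W[OF assms(2)] by (simp only: dep_0 one_eSuc)
    ultimately show ?case unfolding w by (simp only: if_distrib[of "dep (attach f0 W u v A)"])
  next
    case (Suc m)
    have c: "(f0 ^^ m) (f0 w) = c" using Suc.prems by (simp add: funpow_swap1)
    have wW: "w \<notin> W"
      using c f0_W[of w] f0_pow_0[of m] assms(2) W0 by auto
    have w0: "w \<noteq> 0"
      using c f0_pow_0[of m] assms(2) W0 by (auto simp: f0_0)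
    have "attach f0 W u v A w = f0 w" using wW assms(3) by (auto simp: attach_def)
    then have "dep (attach f0 W u v A) w = eSuc (dep (attach f0 W u v A) (f0 w))"
      using dep_step[OF w0, of "attach f0 W u v A"] by (simp only:)
    moreover have "dep f0 w = eSuc (dep f0 (f0 w))" by (rule dep_step[OF w0])
    ultimately show ?case by (simp only: Suc.IH[OF c] iadd_Suc)
  qed
qed

lemma lands_dep_finite:
  assumes "lands f0 w c" "c \<in> W"
  shows "dep f0 w < \<infinity>"
proof -
  from assms(1) obtain m where "(f0 ^^ m) w = c" by (auto simp: lands_def)
  then have "(f0 ^^ Suc m) w = 0" using assms(2) f0_W by simp
  then have "\<exists>m. (f0 ^^ m) w = 0" by (rule exI)
  then show ?thesis by (simp add: dep_def)
qed

lemma free_dep: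
  assumes "\<And>c. c \<in> W \<Longrightarrow> \<not> lands f0 w c" "A \<subseteq> W"
  shows "dep (attach f0 W u v A) w = dep f0 w"
proof (rule dep_cong)
  fix m show "(attach f0 W u v A ^^ m) w = (f0 ^^ m) w"
  proof (induction m)
    case (Suc m)
    have "(f0 ^^ m) w \<notin> W" using assms(1) by (auto simp: lands_def)
    then show ?case using Suc assms(2) by (auto simp: attach_def)
  qed simp
qed

text \<open>In \<open>f0\<close> a vertex of \<open>W\<close> is followed by 0, where the walk
  stays, so a walk meets \<open>W\<close> at most once.\<close>

lemma lands_unique:
  assumes "lands f0 w c" "lands f0 w c'" "c \<in> W" "c' \<in> W"
  shows "c = c'"
proof -
  have *: False if "(f0 ^^ m) w \<in> W" "(f0 ^^ m') w \<in> W" "m < m'" for m m'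
  proof -
    have "(f0 ^^ Suc m) w = 0" using f0_W[OF that(1)] by simp
    moreover have "(f0 ^^ m') w = (f0 ^^ (m' - Suc m)) ((f0 ^^ Suc m) w)"
      using that(3) by (metis Suc_leI funpow_add le_add_diff_inverse2 o_apply)
    ultimately have "(f0 ^^ m') w = 0" by (simp add: f0_pow_0 del: funpow.simps)
    then show False using that(2) W0 by simp
  qed
  from assms obtain m m' where m: "(f0 ^^ m) w = c" "(f0 ^^ m') w = c'" by (auto simp: lands_def)
  have "m = m'" using *[of m m'] *[of m' m] m assms by (metis linorder_neqE_nat)
  with m show ?thesis by simp
qed

text \<open>Exchanging \<open>u\<close> and \<open>v\<close> amounts to complementing
  \<open>A\<close>; this halves the case analysis below.\<close>

lemma attach_compl: "A \<subseteq> W \<Longrightarrow> attach f0 W v u (W - A) = attach f0 W u v A"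
  by (auto simp: attach_def fun_eq_iff)

lemma shallow_swap: "A \<subseteq> W \<Longrightarrow> A \<in> shallow f0 W V T u v \<longleftrightarrow> W - A \<in> shallow f0 W V T v u"
  by (simp add: shallow_def attach_compl)

text \<open>As \<open>u\<close> lies below no cut-off vertex, its depth \<open>x\<close> is the same
  for every \<open>A\<close>, and \<open>v\<close> then has one depth \<open>y \<ge> x\<close> for
  all admissible \<open>A\<close>. Hence hanging a subtree below \<open>u\<close> is never worse
  than hanging it below \<open>v\<close>. Given one admissible \<open>A0\<close>, everything may
  hang below \<open>u\<close>, and whether a cut-off vertex may hang below \<open>v\<close> is
  decided for each vertex separately; \<open>K\<close> collects those that may.\<close>

lemma shallow_free:
  assumes V: "u \<in> V" "v \<in> V" "W \<subseteq> V" and nz: "v \<noteq> 0" and fin: "finite W"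
  and u: "\<And>c. c \<in> W \<Longrightarrow> \<not> lands f0 u c"
  and v: "(\<And>c. c \<in> W \<Longrightarrow> \<not> lands f0 v c) \<Longrightarrow> dep f0 u \<le> dep f0 v"
  and A0: "A0 \<in> shallow f0 W V T u v"
  obtains K where "K \<subseteq> W" "T = \<infinity> \<Longrightarrow> card W \<le> card K + 1" "shallow f0 W V T u v = Pow K"
proof -
  define x y where "x = dep f0 u" and "y = dep (attach f0 W u v A0) v"
  \<comment> \<open>\<open>B\<close> contains the cut-off ancestor of \<open>v\<close>, if there is
    one. It may not hang below \<open>v\<close>.\<close>
  define B where "B = {c \<in> W. lands f0 v c}"
  define K where "K = {c \<in> W - B. \<forall>w\<in>V. lands f0 w c \<longrightarrow> dep f0 w + y < T}"
  have du: "dep (attach f0 W u v A) u = x" if "A \<subseteq> W" for A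
    using free_dep[OF u that] by (simp add: x_def)
  have A0': "A0 \<subseteq> W" "\<And>w. w \<in> V \<Longrightarrow> dep (attach f0 W u v A0) w < T"
    using A0 by (auto simp: shallow_def)
  \<comment> \<open>Hanging an ancestor of \<open>v\<close> below \<open>v\<close> closes a cycle:
    the depth of \<open>v\<close> exceeds itself by a positive amount, so it is infinite.\<close>
  have dinf: "dep (attach f0 W u v A) v = \<infinity>" if "A \<subseteq> W" "c \<in> A" "c \<in> B" for A c
  proof -
    have "dep (attach f0 W u v A) v = dep f0 v + dep (attach f0 W u v A) v"
      using lands_dep[of v c A u v] that by (auto simp: B_def)
    moreover have "dep f0 v \<noteq> 0" using nz by simp
    ultimately show ?thesis
      by (cases "dep (attach f0 W u v A) v"; cases "dep f0 v") (auto simp: zero_enat_def)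
  qed
  have B_not: "A \<inter> B = {}" if "A \<in> shallow f0 W V T u v" for A
    using that dinf[of A] V(2) unfolding shallow_def by fastforce
  have dv: "dep (attach f0 W u v A) v = (if B = {} then dep f0 v else dep f0 v + x)"
    if "A \<subseteq> W" "A \<inter> B = {}" for A
  proof (cases "B = {}")
    case True
    then have "\<And>c. c \<in> W \<Longrightarrow> \<not> lands f0 v c" by (auto simp: B_def)
    with that True show ?thesis by (simp add: free_dep)
  next
    case False
    then obtain c where "c \<in> B" by blast
    with that have c: "c \<in> W" "lands f0 v c" "c \<notin> A" by (auto simp: B_def)
    with False that show ?thesis using lands_dep[of v c A u v] du by simp
  qed
  have dvy: "dep (attach f0 W u v A) v = y" if "A \<subseteq> W" "A \<inter> B = {}" for A
    using dv[OF that] dv[of A0] A0' B_not[OF A0] by (simp add: y_def)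
  have xy: "x \<le> y"
  proof (cases "B = {}")
    case True
    then have "\<And>c. c \<in> W \<Longrightarrow> \<not> lands f0 v c" by (auto simp: B_def)
    with v have "x \<le> dep f0 v" by (simp add: x_def)
    with dv[of A0] A0' B_not[OF A0] True show ?thesis by (simp add: y_def)
  next
    case False
    with dv[of A0] A0' B_not[OF A0] show ?thesis by (simp add: y_def)
  qed
  show ?thesis
  proof
    show "K \<subseteq> W" by (auto simp: K_def)
    show "shallow f0 W V T u v = Pow K"
    proof (intro equalityI subsetI)
      fix A assume A: "A \<in> shallow f0 W V T u v"
      then have AW: "A \<subseteq> W" and AT: "\<And>w. w \<in> V \<Longrightarrow> dep (attach f0 W u v A) w < T"
        by (auto simp: shallow_def)
      show "A \<in> Pow K"
      proof (intro PowI subsetI)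
        fix c assume c: "c \<in> A"
        have "dep f0 w + y < T" if "w \<in> V" "lands f0 w c" for w
          using AT[OF that(1)] lands_dep[of w c A u v] that c AW dvy[OF AW B_not[OF A]] by auto
        then show "c \<in> K" using c AW B_not[OF A] by (auto simp: K_def)
      qed
    next
      fix A assume "A \<in> Pow K"
      then have A: "A \<subseteq> K" by simp
      then have AW: "A \<subseteq> W" and AB: "A \<inter> B = {}" by (auto simp: K_def)
      have "dep (attach f0 W u v A) w < T" if w: "w \<in> V" for w
      proof (cases "\<exists>c\<in>W. lands f0 w c")
        case True
        then obtain c where c: "c \<in> W" "lands f0 w c" by blast
        show ?thesis
        proof (cases "c \<in> A")
          case True
          then show ?thesis using A c w lands_dep[OF c(2,1) AW, of u v] dvy[OF AW AB]
            by (auto simp: K_def)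
        next
          case False
          then have "dep (attach f0 W u v A) w = dep f0 w + x"
            using lands_dep[OF c(2,1) AW, of u v] du[OF AW] by simp
          \<comment> \<open>In \<open>A0\<close> the subtree of \<open>c\<close> hangs at depth
            \<open>x\<close> or \<open>y\<close>, both at least \<open>x\<close>.\<close>
          also have "\<dots> \<le> dep (attach f0 W u v A0) w"
            using lands_dep[OF c(2,1) A0'(1), of u v] du[OF A0'(1)] xy
            by (simp add: y_def add_left_mono split: if_splits)
          also have "\<dots> < T" using A0' w by simp
          finally show ?thesis .
        qed
      next
        case False
        then have "dep (attach f0 W u v A) w = dep (attach f0 W u v A0) w"
            using free_dep[of w A u v] free_dep[of w A0 u v] A0'(1) AW by auto
          then show ?thesis using A0'(2)[OF w] by simp
      qed
      then show "A \<in> shallow f0 W V T u v" using AW by (simp add: shallow_def)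
    qed
    assume T: "T = \<infinity>"
    have y: "y < \<infinity>" using A0'(2)[OF V(2)] T by (simp add: y_def)
    \<comment> \<open>Without a height bound only the cycle condition remains, so \<open>K\<close>
      misses at most the one element of \<open>B\<close>.\<close>
    have "c \<in> K" if "c \<in> W - B" for c
      using that y lands_dep_finite[of _ c] T by (fastforce simp: K_def plus_eq_infty_iff_enat)
    then have K: "K = W - B" by (auto simp: K_def)
    have "card B \<le> 1"
      using lands_unique[of v] fin card_le_Suc0_iff_eq[of B] by (auto simp: B_def)
    moreover have "card W = card K + card B"
    proof -
      have "B \<subseteq> W" by (auto simp: B_def)
      with fin show ?thesis unfolding K
        by (simp add: card_Diff_subset card_mono finite_subset)
    qed
    ultimately show "card W \<le> card K + 1" by simp
  qed
qed

text \<open>One of \<open>u\<close> and \<open>v\<close> is free of cut-off ancestors; if both are,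
  the one of smaller depth plays the role of \<open>u\<close> in \<open>shallow_free\<close>. The
  last outcome is the mirror image of the second, with the roles of \<open>u\<close> and
  \<open>v\<close> exchanged.\<close>

lemma shallow_structure:
  assumes V: "u \<in> V" "v \<in> V" "W \<subseteq> V" and nz: "u \<noteq> 0" "v \<noteq> 0" and fin: "finite W"
  obtains "shallow f0 W V T u v = {}"
  | K where "K \<subseteq> W" "T = \<infinity> \<Longrightarrow> card W \<le> card K + 1" "shallow f0 W V T u v = Pow K"
  | K where "K \<subseteq> W" "T = \<infinity> \<Longrightarrow> card W \<le> card K + 1"
      "shallow f0 W V T u v = {A. A \<subseteq> W \<and> W - A \<subseteq> K}"
proof (cases "shallow f0 W V T u v = {}")
  case False
  then obtain A0 where A0: "A0 \<in> shallow f0 W V T u v" by auto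
  then have A0': "A0 \<subseteq> W" by (auto simp: shallow_def)
  have A0s: "W - A0 \<in> shallow f0 W V T v u" using A0 shallow_swap[OF A0', of V T u v] by simp
  define uf where "uf \<longleftrightarrow> (\<forall>c\<in>W. \<not> lands f0 u c)"
  define vf where "vf \<longleftrightarrow> (\<forall>c\<in>W. \<not> lands f0 v c)"
  \<comment> \<open>Otherwise the depths of \<open>u\<close> and \<open>v\<close>, finite because
    \<open>A0\<close> is admissible, would each strictly exceed one of the two, which is impossible
    for the smaller one.\<close>
  have "uf \<or> vf"
  proof (rule ccontr)
    assume "\<not> (uf \<or> vf)"
    then obtain cu cv where c: "cu \<in> W" "lands f0 u cu" "cv \<in> W" "lands f0 v cv"
      by (auto simp: uf_def vf_def)
    let ?d = "dep (attach f0 W u v A0)"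
    have du: "?d u = dep f0 u + (if cu \<in> A0 then ?d v else ?d u)"
      by (rule lands_dep) (use c A0' in auto)
    have dv: "?d v = dep f0 v + (if cv \<in> A0 then ?d v else ?d u)"
      by (rule lands_dep) (use c A0' in auto)
    have dnz: "dep f0 u \<noteq> 0" "dep f0 v \<noteq> 0" using nz by auto
    have loop: False
      if "enat p = a + (if P then enat q else enat p)" "enat q = b + (if Q then enat q else enat p)"
        "a \<noteq> 0" "b \<noteq> 0"
      for p q a b P Q
      using that by (cases a; cases b) (auto simp: zero_enat_def split: if_splits)
    have "?d u < T" "?d v < T" using A0 V by (simp_all add: shallow_def)
    then obtain p q where pq: "?d u = enat p" "?d v = enat q"
      by (metis not_infinity_eq enat_ord_simps(6))
    show False using loop[OF du[unfolded pq] dv[unfolded pq] dnz] .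
  qed
  then consider "uf" "vf \<Longrightarrow> dep f0 u \<le> dep f0 v" | "vf" "uf \<Longrightarrow> dep f0 v \<le> dep f0 u"
    using linear[of "dep f0 u" "dep f0 v"] by blast
  then show ?thesis
  proof cases
    case 1
    have fr: "\<not> lands f0 u c" if "c \<in> W" for c using 1(1) that by (simp add: uf_def)
    have le: "dep f0 u \<le> dep f0 v" if "\<And>c. c \<in> W \<Longrightarrow> \<not> lands f0 v c"
      by (rule 1(2)) (use that in \<open>simp add: vf_def\<close>)
    obtain K where "K \<subseteq> W" "T = \<infinity> \<Longrightarrow> card W \<le> card K + 1" "shallow f0 W V T u v = Pow K"
      using shallow_free[OF V nz(2) fin fr le A0] by blast
    then show ?thesis by (rule that(2))
  next
    case 2
    have fr: "\<not> lands f0 v c" if "c \<in> W" for c using 2(1) that by (simp add: vf_def)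
    have le: "dep f0 v \<le> dep f0 u" if "\<And>c. c \<in> W \<Longrightarrow> \<not> lands f0 u c"
      by (rule 2(2)) (use that in \<open>simp add: uf_def\<close>)
    obtain K where K: "K \<subseteq> W" "T = \<infinity> \<Longrightarrow> card W \<le> card K + 1" "shallow f0 W V T v u = Pow K"
      using shallow_free[OF V(2,1,3) nz(1) fin fr le A0s] by blast
    have "A \<in> shallow f0 W V T u v \<longleftrightarrow> A \<subseteq> W \<and> W - A \<subseteq> K" for A
    proof (cases "A \<subseteq> W")
      case True
      then show ?thesis using K(3) shallow_swap[of A V T u v] by simp
    qed (simp add: shallow_def)
    then have "shallow f0 W V T u v = {A. A \<subseteq> W \<and> W - A \<subseteq> K}" by blast
    with K(1,2) show ?thesis by (rule that(3))
  qed
qed (rule that(1))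

end

section \<open>Counting parent maps\<close>

text \<open>For \<open>T = \<infinity>\<close> the condition on \<open>dep\<close> says that every vertex reaches the root.\<close>

definition parent_maps :: "'a::zero set \<Rightarrow> ('a \<Rightarrow> nat) \<Rightarrow> enat \<Rightarrow> ('a \<Rightarrow> 'a) set" where
  "parent_maps V \<delta> T =
     {f. (\<forall>w. w \<notin> V \<longrightarrow> f w = 0) \<and> (\<forall>w\<in>V. f w \<in> insert 0 V) \<and>
         (\<forall>i\<in>V. card {w \<in> V. f w = i} = \<delta> i) \<and> (\<forall>w\<in>V. dep f w < T)}"

lemma finite_parent_maps: "finite V \<Longrightarrow> finite (parent_maps V \<delta> T)"
  by (rule finite_subset[OF _ finite_set_of_finite_funs[of V "insert 0 V" 0]])
     (auto simp: parent_maps_def)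

lemma parent_maps_cong:
  "(\<And>i. i \<in> V \<Longrightarrow> \<delta> i = \<delta>' i) \<Longrightarrow> parent_maps V \<delta> T = parent_maps V \<delta>' T"
  by (simp add: parent_maps_def)

lemma dep_conj:
  assumes "\<And>x. \<tau> (\<tau> x) = x" "\<tau> 0 = 0"
  shows "dep (\<lambda>x. \<tau> (f (\<tau> x))) w = dep f (\<tau> w)"
proof -
  have pow: "((\<lambda>x. \<tau> (f (\<tau> x))) ^^ m) w = \<tau> ((f ^^ m) (\<tau> w))" for m
    by (induction m) (auto simp: assms)
  have "\<tau> x = 0 \<longleftrightarrow> x = 0" for x
    using assms by metis
  then show ?thesis by (simp add: dep_def pow)
qed

text \<open>Conjugation by the involution \<open>\<tau>\<close> maps each set into the other and is
  its own inverse.\<close>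

lemma card_parent_maps_relabel:
  assumes \<tau>: "\<And>x. \<tau> (\<tau> x) = x" "\<tau> 0 = 0" "\<And>x. x \<in> V \<Longrightarrow> \<tau> x \<in> V"
  shows "card (parent_maps V (\<lambda>i. \<delta> (\<tau> i)) T) = card (parent_maps V \<delta> T)"
proof -
  let ?c = "\<lambda>f x. \<tau> (f (\<tau> x))"
  have V: "\<tau> x \<in> V \<longleftrightarrow> x \<in> V" for x using \<tau> by metis
  have z: "\<tau> x = 0 \<longleftrightarrow> x = 0" for x using \<tau> by metis
  have ch: "card {w \<in> V. ?c f w = i} = card {w \<in> V. f w = \<tau> i}" for f i
  proof -
    have "{w \<in> V. ?c f w = i} = \<tau> ` {w \<in> V. f w = \<tau> i}"
      using \<tau> V by (auto simp: image_iff) metis+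
    moreover have "inj \<tau>" using \<tau>(1) by (metis injI)
    ultimately show ?thesis by (simp add: card_image inj_on_subset)
  qed
  have in1: "?c f \<in> parent_maps V (\<lambda>i. \<epsilon> (\<tau> i)) T" if "f \<in> parent_maps V \<epsilon> T" for f \<epsilon>
    using that unfolding parent_maps_def
    by (auto simp: ch V z dep_conj[OF \<tau>(1,2)] \<tau>)
  have "bij_betw ?c (parent_maps V \<delta> T) (parent_maps V (\<lambda>i. \<delta> (\<tau> i)) T)"
  proof (rule bij_betw_byWitness[where f' = ?c])
    show "?c ` parent_maps V \<delta> T \<subseteq> parent_maps V (\<lambda>i. \<delta> (\<tau> i)) T" using in1 by blast
    show "?c ` parent_maps V (\<lambda>i. \<delta> (\<tau> i)) T \<subseteq> parent_maps V \<delta> T"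
      using in1[of _ "\<lambda>i. \<delta> (\<tau> i)"] by (auto simp: \<tau>)
  qed (auto simp: \<tau>)
  then show ?thesis by (simp add: bij_betw_same_card)
qed

lemma card_parent_maps_swap:
  assumes "u \<in> V" "v \<in> V" "u \<noteq> v" "0 \<notin> V"
  shows "card (parent_maps V (\<delta>(u := p, v := q)) T) = card (parent_maps V (\<delta>(u := q, v := p)) T)"
proof -
  have "card (parent_maps V (\<lambda>i. (\<delta>(u := p, v := q)) (Transposition.transpose u v i)) T)
      = card (parent_maps V (\<delta>(u := p, v := q)) T)"
    by (rule card_parent_maps_relabel) (use assms in \<open>auto simp: Transposition.transpose_def\<close>)
  moreover have "(\<lambda>i. (\<delta>(u := p, v := q)) (Transposition.transpose u v i)) = \<delta>(u := q, v := p)"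
    using assms by (auto simp: Transposition.transpose_def fun_eq_iff)
  ultimately show ?thesis by simp
qed

section \<open>Fibres of parent maps with the same remainder after cutting off the children of
  \<open>u\<close> and \<open>v\<close>\<close>

definition fiber_key :: "'a::zero \<Rightarrow> 'a \<Rightarrow> ('a \<Rightarrow> 'a) \<Rightarrow> ('a \<Rightarrow> 'a) \<times> 'a set" where
  "fiber_key u v f = (\<lambda>w. if f w \<in> {u, v} then 0 else f w, {w. f w \<in> {u, v}})"

lemma attach_fiber_key:
  "fiber_key u v f = (f0, W) \<Longrightarrow> attach f0 W u v {w. f w = v} = f"
  by (auto simp: fiber_key_def attach_def)

text \<open>Within a fibre a parent map is determined by the set \<open>A\<close> of children of
  \<open>v\<close>, and \<open>attach\<close> recovers the map from \<open>A\<close>. So the maps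
  giving \<open>v\<close> exactly \<open>j\<close> children correspond to the
  \<open>j\<close>-element members of \<open>shallow\<close>.\<close>

lemma fiber_cases:
  fixes f0 :: "'a::zero \<Rightarrow> 'a" and \<delta> :: "'a \<Rightarrow> nat" and S :: nat and V W :: "'a set"
    and u v :: 'a and T :: enat
  assumes V: "finite V" "0 \<notin> V" "u \<in> V" "v \<in> V" "u \<noteq> v"
  defines "E \<equiv> \<lambda>j. {f \<in> parent_maps V (\<delta>(u := S - j, v := j)) T. fiber_key u v f = (f0, W)}"
  obtains "\<And>j. j \<le> S \<Longrightarrow> E j = {}"
  | "f0 0 = 0" "\<And>c. c \<in> W \<Longrightarrow> f0 c = 0" "0 \<notin> W" "W \<subseteq> V" "card W = S"
    "\<And>j. j \<le> S \<Longrightarrow> card (E j) = card {A \<in> shallow f0 W V T u v. card A = j}"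
proof -
  \<comment> \<open>\<open>P\<close> collects the conditions on the remainder that do not mention
    \<open>j\<close>. If it fails, the fibre is empty for every \<open>j \<le> S\<close>.\<close>
  define P where "P \<longleftrightarrow> (\<forall>w. w \<notin> V \<longrightarrow> f0 w = 0) \<and> (\<forall>w\<in>V. f0 w \<in> insert 0 V - {u, v}) \<and>
    W \<subseteq> V \<and> card W = S \<and> (\<forall>c\<in>W. f0 c = 0) \<and> (\<forall>i\<in>V - {u, v}. card {w \<in> V. f0 w = i} = \<delta> i)"
  have nz: "u \<noteq> 0" "v \<noteq> 0" using V by auto
  have EP: P if f: "f \<in> E j" and j: "j \<le> S" for f j
  proof -
    from f have pm: "f \<in> parent_maps V (\<delta>(u := S - j, v := j)) T"
      and f0: "f0 = (\<lambda>w. if f w \<in> {u, v} then 0 else f w)" and W: "W = {w. f w \<in> {u, v}}"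
      by (auto simp: E_def fiber_key_def)
    have out: "\<And>w. w \<notin> V \<Longrightarrow> f w = 0" using pm by (auto simp: parent_maps_def)
    have WV: "W \<subseteq> V" using out nz W by (metis (no_types, lifting) insert_iff mem_Collect_eq singletonD subsetI)
    have "W = {w \<in> V. f w = u} \<union> {w \<in> V. f w = v}" using WV W by auto
    moreover have "card {w \<in> V. f w = u} = S - j" "card {w \<in> V. f w = v} = j"
      using pm V by (auto simp: parent_maps_def)
    moreover have "card ({w \<in> V. f w = u} \<union> {w \<in> V. f w = v})
        = card {w \<in> V. f w = u} + card {w \<in> V. f w = v}"
      using V by (intro card_Un_disjoint) auto
    ultimately have cW: "card W = S" using j by simp
    have "card {w \<in> V. f0 w = i} = \<delta> i" if "i \<in> V - {u, v}" for i
    proof -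
      have "{w \<in> V. f0 w = i} = {w \<in> V. f w = i}" using that V by (auto simp: f0)
      moreover have "card {w \<in> V. f w = i} = \<delta> i" using pm that by (auto simp: parent_maps_def)
      ultimately show ?thesis by simp
    qed
    moreover have "\<forall>w\<in>V. f0 w \<in> insert 0 V - {u, v}"
      using pm nz by (auto simp: parent_maps_def f0)
    ultimately show P unfolding P_def using WV cW out by (auto simp: f0 W)
  qed
  show ?thesis
  proof (cases P)
    case False
    then have "E j = {}" if "j \<le> S" for j using EP that by blast
    then show ?thesis by (rule that(1))
  next
    case True
    then have P: "\<And>w. w \<notin> V \<Longrightarrow> f0 w = 0" "\<And>w. w \<in> V \<Longrightarrow> f0 w \<in> insert 0 V - {u, v}" "W \<subseteq> V" "card W = S"
      "\<And>c. c \<in> W \<Longrightarrow> f0 c = 0" "\<And>i. i \<in> V - {u, v} \<Longrightarrow> card {w \<in> V. f0 w = i} = \<delta> i"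
      unfolding P_def using nz by blast+
    have P2: "f0 w \<in> insert 0 V - {u, v}" for w
      using P(1,2)[of w] nz by (cases "w \<in> V") auto
    have ne: "f0 w \<noteq> u" "f0 w \<noteq> v" for w using P2[of w] by auto
    have W0: "0 \<notin> W" using P(3) V by auto
    have f00: "f0 0 = 0" using P(1) V by auto
    have att_v: "attach f0 W u v A w = v \<longleftrightarrow> w \<in> A" and
      att_u: "attach f0 W u v A w = u \<longleftrightarrow> w \<in> W - A" if "A \<subseteq> W" for A w
      using that V(5) ne by (auto simp: attach_def)
    have bij: "bij_betw (attach f0 W u v) {A \<in> shallow f0 W V T u v. card A = j} (E j)"
      if j: "j \<le> S" for j
    proof (rule bij_betw_byWitness[where f' = "\<lambda>f. {w. f w = v}"])
      show "\<forall>A\<in>{A \<in> shallow f0 W V T u v. card A = j}. {w. attach f0 W u v A w = v} = A"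
        by (auto simp: shallow_def att_v)
      show "\<forall>f\<in>E j. attach f0 W u v {w. f w = v} = f"
        by (auto simp: E_def intro: attach_fiber_key)
      show "attach f0 W u v ` {A \<in> shallow f0 W V T u v. card A = j} \<subseteq> E j"
      proof (intro image_subsetI)
        fix A assume A: "A \<in> {A \<in> shallow f0 W V T u v. card A = j}"
        let ?f = "attach f0 W u v A"
        have AW: "A \<subseteq> W" and dA: "\<And>w. w \<in> V \<Longrightarrow> dep ?f w < T" and cA: "card A = j"
          using A by (auto simp: shallow_def)
        have "{w \<in> V. ?f w = u} = W - A" using att_u[OF AW] P(3) by auto
        then have cu: "card {w \<in> V. ?f w = u} = S - j"
          using AW cA P(4) finite_subset[OF P(3) V(1)] by (simp add: card_Diff_subset finite_subset)
        have "{w \<in> V. ?f w = v} = A" using att_v[OF AW] P(3) AW by auto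
        then have cv: "card {w \<in> V. ?f w = v} = j" using cA by simp
        have ci: "card {w \<in> V. ?f w = i} = \<delta> i" if i: "i \<in> V - {u, v}" for i
        proof -
          have "i \<noteq> 0" using i V by auto
          then have "{w \<in> V. ?f w = i} = {w \<in> V. f0 w = i}"
            using i P(5) AW by (auto simp: attach_def split: if_splits)
          then show ?thesis using P(6)[OF i] by simp
        qed
        have rng: "?f w \<in> insert 0 V" for w using P2[of w] V by (auto simp: attach_def)
        have out: "?f w = 0" if "w \<notin> V" for w
          using that P(1,3) AW by (auto simp: attach_def)
        have "?f \<in> parent_maps V (\<delta>(u := S - j, v := j)) T"
          using cu cv ci rng out dA V(5) by (auto simp: parent_maps_def)
        moreover have "fiber_key u v ?f = (f0, W)"
          using att_u[OF AW] att_v[OF AW] AW P(5) by (auto simp: fiber_key_def fun_eq_iff attach_def)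
        ultimately show "?f \<in> E j" by (simp add: E_def)
      qed
      show "(\<lambda>f. {w. f w = v}) ` E j \<subseteq> {A \<in> shallow f0 W V T u v. card A = j}"
      proof (intro image_subsetI)
        fix f assume f: "f \<in> E j"
        let ?A = "{w. f w = v}"
        have "attach f0 W u v ?A = f"
          using f by (auto simp: E_def intro: attach_fiber_key)
        moreover have "?A \<subseteq> W" using f by (auto simp: E_def fiber_key_def)
        moreover have pm: "f \<in> parent_maps V (\<delta>(u := S - j, v := j)) T" using f by (simp add: E_def)
        moreover have "?A = {w \<in> V. f w = v}" using pm nz by (auto simp: parent_maps_def)
        ultimately show "?A \<in> {A \<in> shallow f0 W V T u v. card A = j}"
          using V(4) by (auto simp: shallow_def parent_maps_def)
      qed
    qed
    show ?thesis
      by (rule that(2)) (use f00 P W0 bij_betw_same_card[OF bij] in auto)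
  qed
qed

lemma card_Pow_co:
  assumes "finite W" "K \<subseteq> W" "j \<le> card W"
  shows "card {A. A \<subseteq> W \<and> W - A \<subseteq> K \<and> card A = j} = card K choose (card W - j)"
proof -
  have "bij_betw (\<lambda>A. W - A) {A. A \<subseteq> W \<and> W - A \<subseteq> K \<and> card A = j} {B. B \<subseteq> K \<and> card B = card W - j}"
  proof (rule bij_betw_byWitness[where f' = "\<lambda>A. W - A"])
    show "(\<lambda>A. W - A) ` {A. A \<subseteq> W \<and> W - A \<subseteq> K \<and> card A = j} \<subseteq> {B. B \<subseteq> K \<and> card B = card W - j}"
      using assms by (auto simp: card_Diff_subset finite_subset)
    show "(\<lambda>A. W - A) ` {B. B \<subseteq> K \<and> card B = card W - j} \<subseteq> {A. A \<subseteq> W \<and> W - A \<subseteq> K \<and> card A = j}"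
    proof (intro image_subsetI CollectI conjI)
      fix B assume "B \<in> {B. B \<subseteq> K \<and> card B = card W - j}"
      then have B: "B \<subseteq> W" "B \<subseteq> K" "card B = card W - j" using assms by auto
      then show "card (W - B) = j"
        using assms by (simp add: card_Diff_subset finite_subset)
    qed auto
  qed (use assms in auto)
  then show ?thesis
    using assms by (simp add: bij_betw_same_card n_subsets finite_subset)
qed

text \<open>The index \<open>j\<close> is the number of children of \<open>v\<close>:
  \<open>b\<close> and \<open>a\<close> are the two orders before the move, \<open>b + 1\<close> and
  \<open>a - 1\<close> the two orders after it. Adding both orders makes the two nonempty outcomes
  of \<open>shallow_structure\<close> yield the same binomial sums, with
  \<open>k = card K\<close>.\<close>

lemma fiber_transfer:
  fixes a b :: nat and \<delta> :: "'a::zero \<Rightarrow> nat" and \<kappa> :: "('a \<Rightarrow> 'a) \<times> 'a set"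
    and u v :: 'a and V :: "'a set" and T :: enat
  assumes V: "finite V" "0 \<notin> V" "u \<in> V" "v \<in> V" "u \<noteq> v" and ab: "b < a"
  defines "e \<equiv> \<lambda>j. card {f \<in> parent_maps V (\<delta>(u := a + b - j, v := j)) T. fiber_key u v f = \<kappa>}"
  shows "(b + 1) * (e (b + 1) + e (a - 1)) \<le> a * (e b + e a)" (is ?le)
    and "T = \<infinity> \<Longrightarrow> (b + 1) * (e (b + 1) + e (a - 1)) = a * (e b + e a)" (is "_ \<Longrightarrow> ?eq")
proof -
  obtain f0 W where \<kappa>: "\<kappa> = (f0, W)" by fastforce
  have j: "b \<le> a + b" "a \<le> a + b" "b + 1 \<le> a + b" "a - 1 \<le> a + b" using ab by auto
  have nz: "u \<noteq> 0" "v \<noteq> 0" using V by auto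
  have "?le \<and> (T = \<infinity> \<longrightarrow> ?eq)"
  proof (rule fiber_cases[OF V, of "a + b" \<delta> T f0 W])
    assume emp: "\<And>j. j \<le> a + b \<Longrightarrow>
      {f \<in> parent_maps V (\<delta>(u := a + b - j, v := j)) T. fiber_key u v f = (f0, W)} = {}"
    have "e j = 0" if "j \<le> a + b" for j
      unfolding e_def \<kappa> by (simp only: emp[OF that] card.empty)
    with j have "e b = 0" "e a = 0" "e (b + 1) = 0" "e (a - 1) = 0" by blast+
    then show ?thesis by (simp only:) simp
  next
    assume f0: "f0 0 = 0" "\<And>c. c \<in> W \<Longrightarrow> f0 c = 0" "0 \<notin> W" and W: "W \<subseteq> V" "card W = a + b"
      and c: "\<And>j. j \<le> a + b \<Longrightarrow>
        card {f \<in> parent_maps V (\<delta>(u := a + b - j, v := j)) T. fiber_key u v f = (f0, W)} =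
        card {A \<in> shallow f0 W V T u v. card A = j}"
    have e: "e j = card {A \<in> shallow f0 W V T u v. card A = j}" if "j \<le> a + b" for j
      unfolding e_def \<kappa> by (rule c[OF that])
    have fin: "finite W" using W V finite_subset by blast
    \<comment> \<open>The two alternatives are the power set of \<open>K\<close> and its mirror
      image; they differ only in the order of the summands.\<close>
    have bin: "?le \<and> (T = \<infinity> \<longrightarrow> ?eq)"
      if "e b = (k choose b) \<and> e a = (k choose a) \<and> e (b + 1) = (k choose (b + 1)) \<and>
          e (a - 1) = (k choose (a - 1)) \<or>
          e b = (k choose a) \<and> e a = (k choose b) \<and> e (b + 1) = (k choose (a - 1)) \<and>
          e (a - 1) = (k choose (b + 1))" "k \<le> a + b" "T = \<infinity> \<Longrightarrow> a + b \<le> k + 1" for k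
    proof -
      have "e (b + 1) + e (a - 1) = (k choose (b + 1)) + (k choose (a - 1))"
        "e b + e a = (k choose b) + (k choose a)"
        using that(1) by linarith+
      with binomial_transfer[OF ab that(2)] that(3) show ?thesis by (simp only:) blast
    qed
    show ?thesis
    proof (rule shallow_structure[where ?f0.0 = f0 and T = T, OF f0 V(3,4) W(1) nz fin])
      assume "shallow f0 W V T u v = {}"
      then have "e j = 0" if "j \<le> a + b" for j by (subst e[OF that]) simp
      with j have "e b = 0" "e a = 0" "e (b + 1) = 0" "e (a - 1) = 0" by blast+
      then show ?thesis by (simp only:) simp
    next
      fix K assume K: "K \<subseteq> W" "T = \<infinity> \<Longrightarrow> card W \<le> card K + 1" "shallow f0 W V T u v = Pow K"
      have "e j = (card K choose j)" if "j \<le> a + b" for j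
        using n_subsets[of K j] finite_subset[OF K(1) fin] by (subst e[OF that]) (simp add: K(3))
      with j have "e b = (card K choose b) \<and> e a = (card K choose a) \<and>
        e (b + 1) = (card K choose (b + 1)) \<and> e (a - 1) = (card K choose (a - 1))" by blast
      moreover have "card K \<le> a + b" "T = \<infinity> \<Longrightarrow> a + b \<le> card K + 1"
        using K(2) W(2) card_mono[OF fin K(1)] by simp_all
      ultimately show ?thesis by (intro bin[of "card K"]) blast+
    next
      fix K assume K: "K \<subseteq> W" "T = \<infinity> \<Longrightarrow> card W \<le> card K + 1"
        "shallow f0 W V T u v = {A. A \<subseteq> W \<and> W - A \<subseteq> K}"
      have "e j = (card K choose (a + b - j))" if "j \<le> a + b" for j
        using card_Pow_co[OF fin K(1), of j] W(2) that by (subst e[OF that]) (simp add: K(3) conj_assoc)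
      moreover have "a + b - (b + 1) = a - 1" "a + b - (a - 1) = b + 1" using ab by auto
      ultimately have "e b = (card K choose a) \<and> e a = (card K choose b) \<and>
        e (b + 1) = (card K choose (a - 1)) \<and> e (a - 1) = (card K choose (b + 1))"
        using j by (simp only: add_diff_cancel_left' add_diff_cancel_right')
      moreover have "card K \<le> a + b" "T = \<infinity> \<Longrightarrow> a + b \<le> card K + 1"
        using K(2) W(2) card_mono[OF fin K(1)] by simp_all
      ultimately show ?thesis by (intro bin[of "card K"]) blast+
    qed
  qed
  then show ?le "T = \<infinity> \<Longrightarrow> ?eq" by auto
qed

text \<open>Summing \<open>fiber_transfer\<close> over all fibres gives the statement for the two
  orders of degrees together, and relabelling \<open>u\<close> and \<open>v\<close> shows that the
  two orders contribute equally.\<close>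

lemma card_parent_maps_transfer:
  fixes \<delta> :: "'a::zero \<Rightarrow> nat" and u v :: 'a and V :: "'a set"
  assumes V: "finite V" "0 \<notin> V" "u \<in> V" "v \<in> V" "u \<noteq> v" and ab: "\<delta> v < \<delta> u"
  defines "\<delta>' \<equiv> \<delta>(u := \<delta> u - 1, v := \<delta> v + 1)"
  shows "(\<delta> v + 1) * card (parent_maps V \<delta>' T) \<le> \<delta> u * card (parent_maps V \<delta> T)"
    and "(\<delta> v + 1) * card (parent_maps V \<delta>' \<infinity>) = \<delta> u * card (parent_maps V \<delta> \<infinity>)"
proof -
  define a b where "a = \<delta> u" and "b = \<delta> v"
  define PM where "PM T j = parent_maps V (\<delta>(u := a + b - j, v := j)) T" for T j
  \<comment> \<open>Keys are collected over all \<open>j\<close>, so that the four counts are sums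
    over the same index set; a key that does not occur for some \<open>j\<close> contributes 0
    there.\<close>
  define Ks where "Ks T = (\<Union>j\<le>a + b. fiber_key u v ` PM T j)" for T
  define e where "e T \<kappa> j = card {f \<in> PM T j. fiber_key u v f = \<kappa>}" for T \<kappa> j
  have ab: "b < a" using ab by (simp add: a_def b_def)
  have fin: "finite (PM T j)" "finite (Ks T)" for T j
    using V by (auto simp: PM_def Ks_def finite_parent_maps)
  have sum: "card (PM T j) = (\<Sum>\<kappa>\<in>Ks T. e T \<kappa> j)" if "j \<le> a + b" for T j
  proof -
    have "fiber_key u v ` PM T j \<subseteq> Ks T" using that by (auto simp: Ks_def)
    from sum.group[OF fin this, of "\<lambda>_. 1::nat"] show ?thesis by (simp add: e_def)
  qed
  have j: "b \<le> a + b" "a \<le> a + b" "b + 1 \<le> a + b" "a - 1 \<le> a + b" using ab by auto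
  have L: "(b + 1) * (card (PM T (b + 1)) + card (PM T (a - 1)))
      = (\<Sum>\<kappa>\<in>Ks T. (b + 1) * (e T \<kappa> (b + 1) + e T \<kappa> (a - 1)))" for T
    using j by (simp only: sum sum_distrib_left[symmetric] sum.distrib)
  have R: "a * (card (PM T b) + card (PM T a)) = (\<Sum>\<kappa>\<in>Ks T. a * (e T \<kappa> b + e T \<kappa> a))" for T
    using j by (simp only: sum sum_distrib_left[symmetric] sum.distrib)
  have swap: "card (PM T (a - 1)) = card (PM T (b + 1))" "card (PM T a) = card (PM T b)" for T
  proof -
    have "a + b - (a - 1) = b + 1" "a + b - (b + 1) = a - 1" using ab by auto
    then show "card (PM T (a - 1)) = card (PM T (b + 1))"
      unfolding PM_def by (simp only: card_parent_maps_swap[OF V(3,4,5,2), of \<delta> "b + 1" "a - 1" T])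
    show "card (PM T a) = card (PM T b)"
      unfolding PM_def using card_parent_maps_swap[OF V(3,4,5,2), of \<delta> b a T] by simp
  qed
  \<comment> \<open>\<open>j = b\<close> gives the degrees before the move and
    \<open>j = b + 1\<close> those after it.\<close>
  have id: "\<delta>(u := a + b - b, v := b) = \<delta>" "\<delta>(u := a + b - (b + 1), v := b + 1) = \<delta>'"
    by (auto simp: a_def b_def \<delta>'_def)
  have "(b + 1) * (card (PM T (b + 1)) + card (PM T (a - 1))) \<le> a * (card (PM T b) + card (PM T a))"
    unfolding L R unfolding e_def PM_def by (rule sum_mono) (rule fiber_transfer[OF V ab])
  then have "2 * ((b + 1) * card (PM T (b + 1))) \<le> 2 * (a * card (PM T b))"
    unfolding swap by (simp only: mult_2 distrib_left)
  then have "(b + 1) * card (PM T (b + 1)) \<le> a * card (PM T b)" by linarith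
  then show "(\<delta> v + 1) * card (parent_maps V \<delta>' T) \<le> \<delta> u * card (parent_maps V \<delta> T)"
    unfolding PM_def id by (simp only: a_def b_def)
  have "(b + 1) * (card (PM \<infinity> (b + 1)) + card (PM \<infinity> (a - 1))) = a * (card (PM \<infinity> b) + card (PM \<infinity> a))"
    unfolding L R unfolding e_def PM_def by (intro sum.cong refl fiber_transfer(2)[OF V ab])
  then have "2 * ((b + 1) * card (PM \<infinity> (b + 1))) = 2 * (a * card (PM \<infinity> b))"
    unfolding swap by (simp only: mult_2 distrib_left)
  then have "(b + 1) * card (PM \<infinity> (b + 1)) = a * card (PM \<infinity> b)" by linarith
  then show "(\<delta> v + 1) * card (parent_maps V \<delta>' \<infinity>) = \<delta> u * card (parent_maps V \<delta> \<infinity>)"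
    unfolding PM_def id by (simp only: a_def b_def)
qed

section \<open>Inserting a vertex of degree 1\<close>

text \<open>If \<open>w\<close> is the root, then \<open>f w = 0\<close> and \<open>z\<close>
  becomes the new root.\<close>

definition insert_above :: "'a \<Rightarrow> ('a \<Rightarrow> 'a) \<times> 'a \<Rightarrow> 'a \<Rightarrow> 'a" where
  "insert_above z = (\<lambda>(f, w). f(z := f w, w := z))"

context
  fixes z w :: "'a::zero" and f g :: "'a \<Rightarrow> 'a" and V :: "'a set"
  assumes z: "z \<notin> V" "z \<noteq> 0" and w: "w \<in> V" and V0: "0 \<notin> V"
    and rng_V: "\<forall>x\<in>V. f x \<in> insert 0 V" and g: "g = insert_above z (f, w)"
begin

lemma rng: "x \<in> V \<Longrightarrow> f x \<in> insert 0 V"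
  using rng_V by blast

lemma insert_above_simps: "g w = z" "g z = f w" "x \<noteq> z \<Longrightarrow> x \<noteq> w \<Longrightarrow> g x = f x"
  using w z by (auto simp: g insert_above_def)

text \<open>The walk in \<open>g\<close> is that in \<open>f\<close> with one extra step through
  \<open>z\<close> whenever it leaves \<open>w\<close>. The induction is strong because one step of
  \<open>f\<close> may cost two steps of \<open>g\<close>.\<close>

lemma dep_le_insert_above:
  assumes "x \<in> insert 0 V"
  shows "dep f x \<le> dep g x"
proof (cases "dep g x")
  case (enat m)
  have "dep g x = enat m \<Longrightarrow> x \<in> insert 0 V \<Longrightarrow> dep f x \<le> enat m"
  proof (induction m arbitrary: x rule: less_induct)
    case (less m)
    show ?case
    proof (cases "x = 0")
      case False
      with less.prems have x: "x \<in> V" "x \<noteq> 0" "x \<noteq> z" using z by auto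
      have fx: "dep f x = eSuc (dep f (f x))" by (rule dep_step[OF x(2)])
      have gx: "dep g x = eSuc (dep g (g x))" by (rule dep_step[OF x(2)])
      obtain k where k: "k < m" "dep g (f x) \<le> enat k"
      proof (cases "x = w")
        case True
        then have "dep g (g x) = eSuc (dep g (f x))"
          using insert_above_simps dep_step[OF z(2), of g] by simp
        with gx less.prems(1) that[of "m - 2"] show ?thesis
          by (cases "dep g (f x)") (auto simp: eSuc_enat)
      next
        case False
        then have "g x = f x" using x insert_above_simps by simp
        with gx less.prems(1) that[of "m - 1"] show ?thesis
          by (cases "dep g (f x)") (auto simp: eSuc_enat)
      qed
      then obtain k' where k': "k' < m" "dep g (f x) = enat k'"
        by (cases "dep g (f x)") auto
      have "dep f (f x) \<le> enat k'" by (rule less.IH[OF k' rng[OF x(1)]])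
      then have "dep f x \<le> enat (Suc k')" by (simp add: fx flip: eSuc_enat)
      also have "\<dots> \<le> enat m" using k' by simp
      finally show ?thesis .
    qed (simp add: zero_enat_def[symmetric])
  qed
  then show ?thesis using enat assms by simp
qed simp

lemma dep_insert_above_finite:
  assumes "\<And>x. x \<in> V \<Longrightarrow> dep f x < \<infinity>" "x \<in> insert z V"
  shows "dep g x < \<infinity>"
proof -
  have V: "dep g x \<noteq> \<infinity>" if "dep f x = enat m" "x \<in> insert 0 V" for m x
    using that
  proof (induction m arbitrary: x)
    case 0
    then show ?case by (simp flip: zero_enat_def)
  next
    case (Suc m)
    show ?case
    proof (cases "x = 0")
      case False
      with Suc.prems have x: "x \<in> V" "x \<noteq> 0" "x \<noteq> z" using z by auto
      have "dep f (f x) = enat m"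
        using Suc.prems(1) dep_step[OF x(2), of f] by (cases "dep f (f x)") (auto simp: eSuc_enat)
      then have fx: "dep g (f x) \<noteq> \<infinity>" using Suc.IH rng[OF x(1)] by blast
      have gx: "dep g x = eSuc (dep g (g x))" by (rule dep_step[OF x(2)])
      show ?thesis
      proof (cases "x = w")
        case True
        then have "dep g (g x) = eSuc (dep g (f x))"
          using insert_above_simps dep_step[OF z(2), of g] by simp
        with gx fx show ?thesis by (cases "dep g (f x)") (auto simp: eSuc_enat)
      next
        case False
        then have "g x = f x" using x insert_above_simps by simp
        with gx fx show ?thesis by (cases "dep g (f x)") (auto simp: eSuc_enat)
      qed
    qed simp
  qed
  have V': "dep g x \<noteq> \<infinity>" if "x \<in> V" for x
    using assms(1)[OF that] V[of x] that by (cases "dep f x") auto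
  show ?thesis
  \<comment> \<open>\<open>z\<close> is the parent of \<open>w\<close>, so its depth is finite
    because that of \<open>w\<close> is.\<close>
  proof (cases "x = z")
    case True
    have "dep g w \<noteq> \<infinity>" by (rule V'[OF w])
    moreover have "dep g w = eSuc (dep g z)"
      using dep_step[of w g] w V0 insert_above_simps by auto
    ultimately show ?thesis using True by (cases "dep g z") auto
  next
    case False
    then show ?thesis using V' assms(2) by auto
  qed
qed

text \<open>At most the children of \<open>f w\<close> change: there \<open>z\<close> takes the
  place of \<open>w\<close>.\<close>

lemma children_insert_above:
  assumes "finite V" "i \<in> V"
  shows "card {x \<in> insert z V. g x = i} = card {x \<in> V. f x = i}"
proof -
  let ?S = "{x \<in> V. f x = i}"
  have iz: "i \<noteq> z" using assms z by auto
  have gx: "x \<in> {x \<in> insert z V. g x = i} \<longleftrightarrow> x = z \<and> f w = i \<or> x \<in> ?S - {w}" for x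
  proof (cases "x = z \<or> x = w")
    case True
    then show ?thesis using insert_above_simps(1,2) iz z(1) w by auto
  next
    case False
    then show ?thesis using insert_above_simps(3)[of x] by auto
  qed
  show ?thesis
  proof (cases "f w = i")
    case True
    have "{x \<in> insert z V. g x = i} = insert z (?S - {w})"
      using gx True by blast
    moreover have "z \<notin> ?S - {w}" "finite (?S - {w})" "finite ?S" "w \<in> ?S"
      using assms z w True by auto
    ultimately show ?thesis
      by (simp only: card_insert_disjoint card_Suc_Diff1 simp_thms)
  next
    case False
    have "{x \<in> insert z V. g x = i} = ?S - {w}" using gx False by blast
    also have "\<dots> = ?S" using False by blast
    finally show ?thesis by (rule arg_cong)
  qed
qed

lemma children_insert_above_new: "{x \<in> insert z V. g x = z} = {w}"
proof -
  have "x = w" if "x \<in> insert z V" "g x = z" for x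
  proof (rule ccontr)
    assume "x \<noteq> w"
    then have "g x \<in> insert 0 V"
      using that insert_above_simps(2,3) rng[of x] rng[OF w] by (cases "x = z") simp_all
    then show False using that(2) z by simp
  qed
  moreover have "w \<in> insert z V" "g w = z" using insert_above_simps(1) w by blast+
  ultimately show ?thesis by blast
qed

end

text \<open>Insertion is undone by contracting \<open>z\<close> onto its only child. Contraction
  does not increase depths, which gives the inclusion for every bound; insertion may increase them,
  so the bijection is stated for \<open>\<infinity>\<close>.\<close>

lemma parent_maps_insert_above:
  assumes V: "finite V" "0 \<notin> V" and z: "z \<notin> V" "z \<noteq> 0"
  shows "bij_betw (insert_above z) (parent_maps V \<delta> \<infinity> \<times> V)
           (parent_maps (insert z V) (\<delta>(z := 1)) \<infinity>)"
    and "parent_maps (insert z V) (\<delta>(z := 1)) T \<subseteq> insert_above z ` (parent_maps V \<delta> T \<times> V)"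
proof -
  have pre: "x \<in> V \<Longrightarrow> f x \<in> insert 0 V" "x \<notin> V \<Longrightarrow> f x = 0" if "f \<in> parent_maps V \<delta> T" for f x T
    using that by (auto simp: parent_maps_def)
  show sub: "parent_maps (insert z V) (\<delta>(z := 1)) T \<subseteq> insert_above z ` (parent_maps V \<delta> T \<times> V)" for T
  proof
    fix g assume g: "g \<in> parent_maps (insert z V) (\<delta>(z := 1)) T"
    have rng: "\<And>x. x \<in> insert z V \<Longrightarrow> g x \<in> insert 0 (insert z V)"
      and out: "\<And>x. x \<notin> insert z V \<Longrightarrow> g x = 0"
      and dg: "\<And>x. x \<in> insert z V \<Longrightarrow> dep g x < T"
      and ch': "\<And>i. i \<in> insert z V \<Longrightarrow> card {x \<in> insert z V. g x = i} = (\<delta>(z := 1)) i"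
      using g unfolding parent_maps_def by blast+
    have ch: "card {x \<in> insert z V. g x = i} = \<delta> i" if "i \<in> V" for i
      using ch'[of i] that z(1) by (metis fun_upd_other insertCI)
    have "card {x \<in> insert z V. g x = z} = 1" using ch'[of z] by (simp only: fun_upd_same insertI1)
    then obtain w where w: "{x \<in> insert z V. g x = z} = {w}" by (rule card_1_singletonE)
    \<comment> \<open>Finite depth forbids \<open>z\<close> to be its own parent, so its only child
      \<open>w\<close> is an old vertex.\<close>
    have gz: "g z \<noteq> z"
    proof
      assume "g z = z"
      then have "dep g z = eSuc (dep g z)" using dep_step[OF z(2), of g] by simp
      then have "dep g z = \<infinity>" by (cases "dep g z") (auto simp: eSuc_enat)
      then show False using dg[of z] by simp
    qed
    have "w \<in> insert z V" and gw: "g w = z" using w by blast+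
    then have wV: "w \<in> V" using gz by blast
    have uniq: "x = w" if "x \<in> insert z V" "g x = z" for x using w that by auto
    define f where "f = g(w := g z, z := 0)"
    have wz: "w \<noteq> z" using wV z by auto
    have gf: "g = insert_above z (f, w)"
      using wz gw by (auto simp: insert_above_def f_def fun_eq_iff)
    have rngf: "f x \<in> insert 0 V" if "x \<in> V" for x
    proof (cases "x = w")
      case True
      then have "f x = g z" using that z(1) by (auto simp: f_def)
      then show ?thesis using rng[of z] gz by auto
    next
      case False
      then have "f x = g x" using that z(1) by (auto simp: f_def)
      then show ?thesis using rng[of x] uniq[of x] False that by auto
    qed
    have outf: "f x = 0" if "x \<notin> V" for x
    proof (cases "x = z")
      case False
      then have "f x = g x" using that wV by (auto simp: f_def)
      then show ?thesis using out[of x] False that by simp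
    qed (simp add: f_def)
    have "\<forall>x\<in>V. f x \<in> insert 0 V" using rngf by blast
    note facts = z wV V(2) this gf
    have "card {x \<in> V. f x = i} = \<delta> i" if "i \<in> V" for i
      using children_insert_above[OF facts V(1) that] ch[OF that] by simp
    moreover have "dep f x < T" if "x \<in> V" for x
      using dep_le_insert_above[OF facts, of x] dg[of x] that
      by (meson insertCI le_less_trans)
    ultimately have "f \<in> parent_maps V \<delta> T"
      using rngf outf unfolding parent_maps_def by blast
    then show "g \<in> insert_above z ` (parent_maps V \<delta> T \<times> V)" using gf wV by blast
  qed
  have sup: "insert_above z (f, w) \<in> parent_maps (insert z V) (\<delta>(z := 1)) \<infinity>"
    if f: "f \<in> parent_maps V \<delta> \<infinity>" and w: "w \<in> V" for f w
  proof -
    let ?g = "insert_above z (f, w)"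
    have "\<forall>x\<in>V. f x \<in> insert 0 V" using pre[OF f] by blast
    note facts = z w V(2) this refl[of ?g]
    have rng: "?g x \<in> insert 0 (insert z V)" if "x \<in> insert z V" for x
      using insert_above_simps(1,2)[OF facts] insert_above_simps(3)[OF facts, of x]
        pre(1)[OF f, of x] pre(1)[OF f w] that
      by (cases "x = z"; cases "x = w") (simp_all, blast+)
    have out: "?g x = 0" if "x \<notin> insert z V" for x
      using pre(2)[OF f, of x] that w by (auto simp: insert_above_def)
    have ch: "card {x \<in> insert z V. ?g x = i} = (\<delta>(z := 1)) i" if "i \<in> insert z V" for i
    proof (cases "i = z")
      case True
      then show ?thesis unfolding True children_insert_above_new[OF facts] by simp
    next
      case False
      then have i: "i \<in> V" using that by simp
      then have "card {x \<in> V. f x = i} = \<delta> i" using f unfolding parent_maps_def by blast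
      then show ?thesis using children_insert_above[OF facts V(1) i] False
        by (simp only: fun_upd_other not_False_eq_True)
    qed
    have "dep ?g x < \<infinity>" if "x \<in> insert z V" for x
      by (rule dep_insert_above_finite[OF facts _ that]) (use f in \<open>unfold parent_maps_def, blast\<close>)
    with rng out ch show ?thesis unfolding parent_maps_def by blast
  qed
  have inj: "inj_on (insert_above z) (parent_maps V \<delta> \<infinity> \<times> V)"
  proof (rule inj_onI)
    fix p q assume p: "p \<in> parent_maps V \<delta> \<infinity> \<times> V" and q: "q \<in> parent_maps V \<delta> \<infinity> \<times> V"
      and eq: "insert_above z p = insert_above z q"
    obtain f w f' w' where [simp]: "p = (f, w)" "q = (f', w')" by fastforce
    have f: "f \<in> parent_maps V \<delta> \<infinity>" "w \<in> V" and f': "f' \<in> parent_maps V \<delta> \<infinity>" "w' \<in> V"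
      using p q by auto
    have "\<forall>x\<in>V. f x \<in> insert 0 V" "\<forall>x\<in>V. f' x \<in> insert 0 V"
      using pre[OF f(1)] pre[OF f'(1)] by blast+
    note fa = z f(2) V(2) this(1) refl[of "insert_above z (f, w)"]
      and fa' = z f'(2) V(2) this(2) refl[of "insert_above z (f', w')"]
    have ww: "w = w'"
      using children_insert_above_new[OF fa] children_insert_above_new[OF fa']
      unfolding eq[simplified] by blast
    have "f x = f' x" for x
    proof (cases "x = z")
      case True
      then show ?thesis using pre[OF f(1)] pre[OF f'(1)] z by simp
    next
      case False
      then show ?thesis
        using insert_above_simps(2)[OF fa] insert_above_simps(2)[OF fa']
          insert_above_simps(3)[OF fa, of x] insert_above_simps(3)[OF fa', of x] eq ww
        by (cases "x = w") simp_all
    qed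
    then show "p = q" using ww by auto
  qed
  show "bij_betw (insert_above z) (parent_maps V \<delta> \<infinity> \<times> V)
           (parent_maps (insert z V) (\<delta>(z := 1)) \<infinity>)"
    unfolding bij_betw_def using inj sub[of \<infinity>] sup by blast
qed

text \<open>The factor \<open>card V\<close> is the number of places for \<open>z\<close>, one above
  each vertex.\<close>

lemma card_parent_maps_insert:
  assumes V: "finite V" "0 \<notin> V" and z: "z \<notin> V" "z \<noteq> 0"
  shows "card (parent_maps (insert z V) (\<delta>(z := 1)) \<infinity>) = card (parent_maps V \<delta> \<infinity>) * card V"
    and "card (parent_maps (insert z V) (\<delta>(z := 1)) T) \<le> card (parent_maps V \<delta> T) * card V"
proof -
  show "card (parent_maps (insert z V) (\<delta>(z := 1)) \<infinity>) = card (parent_maps V \<delta> \<infinity>) * card V"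
    using bij_betw_same_card[OF parent_maps_insert_above(1)[OF assms]]
    by (simp add: card_cartesian_product)
  have "finite (parent_maps V \<delta> T \<times> V)" using V finite_parent_maps by auto
  then show "card (parent_maps (insert z V) (\<delta>(z := 1)) T) \<le> card (parent_maps V \<delta> T) * card V"
    using surj_card_le[OF _ parent_maps_insert_above(2)[OF assms]]
    by (metis card_cartesian_product)
qed

section \<open>Parent maps of rooted trees\<close>

text \<open>The parent is chosen as a neighbour one step nearer to the root. The value 0 at the root
  and outside the tree matches the convention of \<open>parent_maps\<close>.\<close>

definition parent_map :: "'a::zero rooted_tree \<Rightarrow> 'a \<Rightarrow> 'a" where
  "parent_map T w =
     (if w \<in> pverts (snd T) - {fst T}
      then SOME p. (w, p) \<in> parcs (snd T) \<and>
             graph_dist (snd T) (fst T) w = graph_dist (snd T) (fst T) p + 1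
      else 0)"

section \<open>From trees to parent maps\<close>

locale rooted_tree_graph = pair_graph G for G :: "'a::zero pair_pre_digraph" +
  fixes r :: 'a
  assumes connected_G: "Digraph_Component.connected (with_proj G)"
    and no_cycle: "\<not> (\<exists>p. cycle p \<and> 3 \<le> length p)"
    and root_in: "r \<in> pverts G" and zero_notin: "0 \<notin> pverts G"
begin

abbreviation gd :: "'a \<Rightarrow> nat" where "gd \<equiv> graph_dist G r"

abbreviation par :: "'a \<Rightarrow> 'a" where "par \<equiv> parent_map (r, G)"

lemma arc_sym: "(u, v) \<in> parcs G \<Longrightarrow> (v, u) \<in> parcs G"
  using arcs_symmetric .

lemma gd_awalk:
  assumes "v \<in> pverts G"
  obtains p where "awalk r p v" "length p = gd v"
proof -
  have "strongly_connected (with_proj G)"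
    using symmetric_connected_imp_strongly_connected connected_G pair_sym_arcs by blast
  then have "r \<rightarrow>\<^sup>*\<^bsub>with_proj G\<^esub> v"
    using assms root_in by (auto simp: strongly_connected_def)
  then have "\<exists>k p. awalk r p v \<and> length p = k" by (auto simp: reachable_awalk)
  from LeastI_ex[OF this] that show ?thesis unfolding graph_dist_def by blast
qed

lemma gd_le: "awalk r p v \<Longrightarrow> gd v \<le> length p"
  unfolding graph_dist_def by (rule Least_le) blast

lemma gd_root: "gd r = 0"
  using gd_le[of "[]" r] root_in by (simp add: awalk_Nil_iff)

lemma gd_arc:
  assumes "(u, v) \<in> parcs G"
  shows "gd v \<le> gd u + 1"
proof -
  obtain p where p: "awalk r p u" "length p = gd u"
    using gd_awalk[of u] in_arcsD1[OF assms] by blast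
  have "awalk r (p @ [(u, v)]) v"
    using p(1) arc_implies_awalk[of "(u, v)"] assms by (intro awalk_appendI) auto
  from gd_le[OF this] p(2) show ?thesis by simp
qed

lemma gd_pred:
  assumes "v \<in> pverts G" "v \<noteq> r"
  obtains p where "(v, p) \<in> parcs G" "gd v = gd p + 1"
proof -
  obtain q where q: "awalk r q v" "length q = gd v" using gd_awalk[OF assms(1)] by blast
  have "q \<noteq> []" using q(1) assms(2) by (auto simp: awalk_Nil_iff)
  then obtain q' e where q': "q = q' @ [e]" by (metis append_butlast_last_id)
  obtain p v' where e: "e = (p, v')" by (cases e)
  have "awalk r q' p \<and> (p, v) \<in> parcs G"
    using q(1) by (auto simp: q' e awalk_simps)
  then have "gd p \<le> length q'" "gd v \<le> gd p + 1" "(v, p) \<in> parcs G"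
    using gd_le gd_arc arc_sym by blast+
  with q(2) q' show ?thesis by (intro that[of p]) auto
qed

lemma par_props:
  assumes "v \<in> pverts G" "v \<noteq> r"
  shows "(v, par v) \<in> parcs G" "gd v = gd (par v) + 1" "par v \<in> pverts G"
proof -
  have "\<exists>p. (v, p) \<in> parcs G \<and> gd v = gd p + 1" using gd_pred[OF assms] by metis
  from someI_ex[OF this] assms
  show "(v, par v) \<in> parcs G" "gd v = gd (par v) + 1"
    by (auto simp: parent_map_def)
  then show "par v \<in> pverts G" using in_arcsD2 by blast
qed

lemma par_root [simp]: "par r = 0" and par_out: "v \<notin> pverts G \<Longrightarrow> par v = 0"
  by (simp_all add: parent_map_def)

lemma par_eq_0_iff: "v \<in> pverts G \<Longrightarrow> par v = 0 \<longleftrightarrow> v = r"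
  using par_props(3)[of v] zero_notin par_root by metis

lemma dep_par: "v \<in> pverts G \<Longrightarrow> dep par v = enat (gd v + 1)"
proof (induction "gd v" arbitrary: v rule: less_induct)
  case less
  have "v \<noteq> 0" using less.prems zero_notin by auto
  note step = dep_step[OF this, of par]
  show ?case
  proof (cases "v = r")
    case True
    then show ?thesis using step by (simp add: gd_root one_eSuc[symmetric] one_enat_def)
  next
    case False
    note p = par_props[OF less.prems False]
    then have "dep par (par v) = enat (gd (par v) + 1)" using less.hyps by simp
    then show ?thesis using step p(2) by (simp add: eSuc_enat)
  qed
qed

definition tree_arcs :: "('a \<times> 'a) set" where
  "tree_arcs = {(w, par w) | w. w \<in> pverts G - {r}} \<union> {(par w, w) | w. w \<in> pverts G - {r}}"

lemma tree_arcs_subset: "tree_arcs \<subseteq> parcs G"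
  using par_props(1) arc_sym by (auto simp: tree_arcs_def)

lemma tree_walk_to_root:
  "v \<in> pverts G \<Longrightarrow> \<exists>p q. awalk v p r \<and> awalk r q v \<and> set p \<subseteq> tree_arcs \<and> set q \<subseteq> tree_arcs"
proof (induction "gd v" arbitrary: v rule: less_induct)
  case less
  show ?case
  proof (cases "v = r")
    case True
    then have "awalk v [] r \<and> awalk r [] v" using root_in by (simp add: awalk_Nil_iff)
    then show ?thesis by (metis empty_subsetI list.set(1))
  next
    case False
    note p = par_props[OF less.prems False]
    then obtain q q' where q: "awalk (par v) q r" "awalk r q' (par v)"
      "set q \<subseteq> tree_arcs" "set q' \<subseteq> tree_arcs"
      using less.hyps[of "par v"] by auto
    have "awalk v ((v, par v) # q) r"
      using q(1) p(1) less.prems by (simp add: awalk_Cons_iff)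
    moreover have "awalk r (q' @ [(par v, v)]) v"
      using q(2) arc_implies_awalk[of "(par v, v)"] arc_sym[OF p(1)] by (intro awalk_appendI) auto
    moreover have "(v, par v) \<in> tree_arcs" "(par v, v) \<in> tree_arcs"
      using less.prems False by (auto simp: tree_arcs_def)
    ultimately show ?thesis using q(3,4)
      by (intro exI[of _ "(v, par v) # q"] exI[of _ "q' @ [(par v, v)]"]) auto
  qed
qed

text \<open>An arc outside the tree of parent arcs would close a cycle with the tree path between its ends.\<close>

lemma arcs_eq_tree_arcs: "parcs G = tree_arcs"
proof
  show "parcs G \<subseteq> tree_arcs"
  proof
    fix e assume e: "e \<in> parcs G"
    obtain u v where uv: "e = (u, v)" by (cases e)
    have V: "u \<in> pverts G" "v \<in> pverts G" using e uv in_arcsD1 in_arcsD2 by auto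
    obtain p where p: "awalk u p r" "set p \<subseteq> tree_arcs"
      using tree_walk_to_root[OF V(1)] by blast
    obtain q where q: "awalk r q v" "set q \<subseteq> tree_arcs"
      using tree_walk_to_root[OF V(2)] by blast
    have w: "awalk u (p @ q) v" using p(1) q(1) by (rule awalk_appendI)
    define s where "s = awalk_to_apath (p @ q)"
    have s: "apath u s v" unfolding s_def by (rule apath_awalk_to_apath[OF w])
    have "set s \<subseteq> set (p @ q)" unfolding s_def by (rule awalk_to_apath_subset[OF w])
    then have sub: "set s \<subseteq> tree_arcs" using p(2) q(2) by auto
    have aw: "awalk u s v" and dist: "distinct (awalk_verts u s)" using s by (auto simp: apath_def)
    show "e \<in> tree_arcs"
    proof (rule ccontr)
      assume n: "e \<notin> tree_arcs"
      have "u \<noteq> v" using e uv no_loops' by auto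
      then have "s \<noteq> []" using aw by (auto simp: awalk_Nil_iff)
      moreover have "s \<noteq> [a]" for a
      proof
        assume "s = [a]"
        then have "a = e" using aw uv by (cases a) (simp add: awalk_simps)
        then show False using sub n \<open>s = [a]\<close> by simp
      qed
      \<comment> \<open>The path has at least two arcs, since a single arc would be \<open>e\<close>
        itself; closing it by the reverse of \<open>e\<close> gives a cycle of length at least
        3.\<close>
      ultimately have "3 \<le> length ((v, u) # s)"
        by (cases s; cases "tl s") auto
      moreover have "cycle ((v, u) # s)"
        unfolding cycle_def
        using aw dist arc_sym e uv V by (intro exI[of _ v]) (simp add: awalk_Cons_iff)
      ultimately show False using no_cycle by blast
    qed
  qed
qed (rule tree_arcs_subset)

text \<open>Every arc at \<open>v\<close> joins a vertex to its parent, and the distance condition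
  in \<open>children\<close> rules out the parent of \<open>v\<close>.\<close>

lemma children_eq:
  assumes "v \<in> pverts G"
  shows "children (r, G) v = {w \<in> pverts G. par w = v}"
proof (intro equalityI subsetI)
  fix w assume "w \<in> children (r, G) v"
  then have w: "(v, w) \<in> parcs G" "gd w = gd v + 1" by (auto simp: children_def)
  from w(1) have "w = par v \<and> v \<noteq> r \<or> v = par w"
    unfolding arcs_eq_tree_arcs by (auto simp: tree_arcs_def)
  moreover have "\<not> (w = par v \<and> v \<noteq> r)"
  proof
    assume "w = par v \<and> v \<noteq> r"
    then show False using w(2) par_props(2)[OF assms] by simp
  qed
  ultimately show "w \<in> {w \<in> pverts G. par w = v}" using in_arcsD2[OF w(1)] by auto
next
  fix w assume w: "w \<in> {w \<in> pverts G. par w = v}"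
  then have "w \<noteq> r" using assms zero_notin par_root by auto
  then show "w \<in> children (r, G) v"
    using w par_props[of w] arc_sym by (auto simp: children_def)
qed

text \<open>The right side refers only to the parent map and not to the vertex set, so two trees
  with the same parent map have the same arcs.\<close>

lemma arcs_eq_par: "parcs G = {(w, p). w \<noteq> 0 \<and> p \<noteq> 0 \<and> (par w = p \<or> par p = w)}"
proof -
  have iff: "w \<in> pverts G - {r} \<longleftrightarrow> w \<noteq> 0 \<and> par w \<noteq> 0" for w
  proof (cases "w \<in> pverts G")
    case True
    then have "w \<noteq> 0" using zero_notin by blast
    then show ?thesis using True par_eq_0_iff[OF True] by simp
  next
    case False
    then show ?thesis using par_out[OF False] by simp
  qed
  have "(w, p) \<in> parcs G \<longleftrightarrow> w \<noteq> 0 \<and> p \<noteq> 0 \<and> (par w = p \<or> par p = w)" for w p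
  proof -
    have "(w, p) \<in> parcs G \<longleftrightarrow>
        w \<in> pverts G - {r} \<and> par w = p \<or> p \<in> pverts G - {r} \<and> par p = w"
    proof -
      have "(w, p) \<in> {(w, h w) | w. w \<in> A} \<union> {(h w, w) | w. w \<in> A} \<longleftrightarrow>
          w \<in> A \<and> h w = p \<or> p \<in> A \<and> h p = w" for A and h :: "'a \<Rightarrow> 'a"
        by auto
      then show ?thesis unfolding arcs_eq_tree_arcs tree_arcs_def .
    qed
    then show ?thesis unfolding iff by blast
  qed
  then show ?thesis by blast
qed

end

section \<open>From parent maps to trees\<close>

definition tree_of_map :: "'a::zero set \<Rightarrow> ('a \<Rightarrow> 'a) \<Rightarrow> 'a pair_pre_digraph" where
  "tree_of_map V f = \<lparr>pverts = V, parcs = {(w, p). w \<in> V \<and> p \<in> V \<and> (f w = p \<or> f p = w)}\<rparr>"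

lemma pcas_chain:
  "pcas u p v \<Longrightarrow>
    (\<forall>i. Suc i < length p \<longrightarrow> snd (p ! i) = fst (p ! Suc i)) \<and>
    (p \<noteq> [] \<longrightarrow> fst (p ! 0) = u \<and> snd (p ! (length p - 1)) = v)"
proof (induction p arbitrary: u)
  case (Cons e p)
  then have IH: "\<And>i. Suc i < length p \<Longrightarrow> snd (p ! i) = fst (p ! Suc i)"
    "p \<noteq> [] \<Longrightarrow> fst (p ! 0) = snd e \<and> snd (p ! (length p - 1)) = v" by auto
  have "snd ((e # p) ! i) = fst ((e # p) ! Suc i)" if "Suc i < length (e # p)" for i
    using that IH by (cases i) auto
  moreover have "fst e = u" "snd ((e # p) ! (length (e # p) - 1)) = v"
    using Cons.prems IH(2) by (cases "p = []"; auto simp: nth_Cons split: nat.split)+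
  ultimately show ?case by simp
qed simp

locale parent_forest =
  fixes V :: "'a::zero set" and f :: "'a \<Rightarrow> 'a" and r :: 'a
  assumes finV: "finite V" and V0: "0 \<notin> V"
    and rng: "\<And>x. x \<in> V \<Longrightarrow> f x \<in> insert 0 V" and out: "\<And>x. x \<notin> V \<Longrightarrow> f x = 0"
    and depf: "\<And>x. x \<in> V \<Longrightarrow> dep f x < \<infinity>"
    and root: "\<And>x. x \<in> V \<Longrightarrow> f x = 0 \<longleftrightarrow> x = r" and rV: "r \<in> V"
begin

abbreviation G where "G \<equiv> tree_of_map V f"

definition lev :: "'a \<Rightarrow> nat" where "lev x = the_enat (dep f x)"

lemma dep_lev: "x \<in> V \<Longrightarrow> dep f x = enat (lev x)"
  using depf[of x] by (auto simp: lev_def)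

lemma lev_parent: "x \<in> V \<Longrightarrow> x \<noteq> r \<Longrightarrow> f x \<in> V \<and> lev x = lev (f x) + 1"
proof -
  assume x: "x \<in> V" "x \<noteq> r"
  then have fx: "f x \<in> V" using rng[of x] root[of x] by auto
  have "x \<noteq> 0" using x V0 by auto
  from dep_step[OF this, of f] show ?thesis
    using fx x dep_lev[of x] dep_lev[OF fx] by (simp add: eSuc_enat)
qed

lemma lev_root: "lev r = 1"
proof -
  have "r \<noteq> 0" using rV V0 by auto
  from dep_step[OF this, of f] dep_lev[OF rV] root[OF rV] show ?thesis
    by (simp add: one_eSuc[symmetric] one_enat_def)
qed

lemma arc_iff: "(w, p) \<in> parcs G \<longleftrightarrow> w \<in> V \<and> p \<in> V \<and> (f w = p \<or> f p = w)"
  by (auto simp: tree_of_map_def)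

lemma pverts_G [simp]: "pverts G = V" by (simp add: tree_of_map_def)

lemma arc_cases:
  assumes "(w, p) \<in> parcs G"
  obtains "w \<in> V" "w \<noteq> r" "p = f w" "lev w = lev p + 1"
  | "p \<in> V" "p \<noteq> r" "w = f p" "lev p = lev w + 1"
proof -
  from assms have wp: "w \<in> V" "p \<in> V" "f w = p \<or> f p = w" by (auto simp: arc_iff)
  show ?thesis
  proof (cases "f w = p")
    case True
    then have "w \<noteq> r" using wp root[of w] V0 by auto
    then show ?thesis using lev_parent[of w] wp True that(1) by auto
  next
    case False
    then have "f p = w" using wp by simp
    moreover then have "p \<noteq> r" using wp root[of p] V0 by auto
    ultimately show ?thesis using lev_parent[of p] wp that(2) by auto
  qed
qed

sublocale pair_graph G
proof
  show "finite (pverts G)" using finV by simp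
  have "parcs G \<subseteq> V \<times> V" by (auto simp: tree_of_map_def)
  then show "finite (parcs G)" using finV finite_subset by blast
  show "symmetric (with_proj G)"
    unfolding symmetric_def sym_def by (auto simp: arcs_ends_conv arc_iff tree_of_map_def)
  show "fst e \<in> pverts G" "snd e \<in> pverts G" if "e \<in> parcs G" for e
    using that by (auto simp: tree_of_map_def)
  show "fst e \<noteq> snd e" if "e \<in> parcs G" for e
  proof (cases e)
    case (Pair w p)
    with that have "(w, p) \<in> parcs G" by simp
    then show ?thesis using Pair by (cases rule: arc_cases) auto
  qed
qed

lemma walk_from_root:
  assumes "v \<in> V"
  shows "\<exists>p. awalk r p v \<and> length p + 1 = lev v"
  using assms
proof (induction "lev v" arbitrary: v rule: less_induct)
  case less
  show ?case
  proof (cases "v = r")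
    case True
    then have "awalk r [] v" using rV by (simp add: awalk_Nil_iff)
    then show ?thesis using True lev_root by (intro exI[of _ "[]"]) simp
  next
    case False
    note p = lev_parent[OF less.prems False]
    then obtain q where q: "awalk r q (f v)" "length q + 1 = lev (f v)"
      using less.hyps[of "f v"] by auto
    have "(f v, v) \<in> parcs G" using p less.prems by (auto simp: arc_iff)
    then have "awalk r (q @ [(f v, v)]) v"
      using q(1) arc_implies_awalk[of "(f v, v)"] by (intro awalk_appendI) auto
    then show ?thesis using q(2) p by (intro exI[of _ "q @ [(f v, v)]"]) simp
  qed
qed

lemma lev_le_walk: "awalk u p v \<Longrightarrow> lev v \<le> lev u + length p"
proof (induction p arbitrary: u)
  case (Cons e p)
  obtain w x where e: "e = (w, x)" by (cases e)
  with Cons.prems have "w = u" "(w, x) \<in> parcs G" "awalk x p v" by (auto simp: awalk_Cons_iff)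
  moreover have "lev x \<le> lev w + 1"
    using calculation(2) by (cases rule: arc_cases) auto
  ultimately show ?case using Cons.IH[of x] by simp
qed (simp add: awalk_Nil_iff)

lemma graph_dist_lev:
  assumes "v \<in> V"
  shows "graph_dist G r v + 1 = lev v"
proof -
  obtain p where p: "awalk r p v" "length p + 1 = lev v" using walk_from_root[OF assms] by blast
  have "graph_dist G r v = length p"
    unfolding graph_dist_def
  proof (rule Least_equality)
    show "\<exists>q. awalk r q v \<and> length q = length p" using p by blast
    show "length p \<le> k" if "\<exists>q. awalk r q v \<and> length q = k" for k
      using that lev_le_walk p(2) lev_root by fastforce
  qed
  with p(2) show ?thesis by simp
qed

lemma connected_G: "Digraph_Component.connected (with_proj G)"
proof -
  have r: "r \<rightarrow>\<^sup>*\<^bsub>with_proj G\<^esub> v" if "v \<in> V" for v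
    using walk_from_root[OF that] by (auto simp: reachable_awalk)
  have "u \<rightarrow>\<^sup>*\<^bsub>with_proj G\<^esub> v" if "u \<in> V" "v \<in> V" for u v
    using symmetric_reachable[OF pair_sym_arcs r[OF that(1)]] r[OF that(2)]
    by (rule reachable_trans)
  then have "u \<rightarrow>\<^sup>*\<^bsub>mk_symmetric (with_proj G)\<^esub> v" if "u \<in> V" "v \<in> V" for u v
    using that by (intro reachable_mk_symmetricI)
  then show ?thesis
    using rV unfolding Digraph_Component.connected_def
    by (intro strongly_connectedI) auto
qed

text \<open>Both neighbours on a cycle of a vertex of maximal level are its parent.\<close>

lemma no_long_cycle: "\<not> (\<exists>p. cycle p \<and> 3 \<le> length p)"
proof
  assume "\<exists>p. cycle p \<and> 3 \<le> length p"
  then obtain p u where p: "awalk u p u" "distinct (tl (awalk_verts u p))" "3 \<le> length p"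
    by (auto simp: cycle_def)
  define n where "n = length p"
  have n: "n \<ge> 3" using p(3) by (simp add: n_def)
  have cas: "pcas u p u" using p(1) by (auto simp: awalk_def)
  have "tl (pawalk_verts x q) = map snd q" if "pcas x q y" for x y and q :: "('a \<times> 'a) list"
    using that
  proof (induction q arbitrary: x)
    case (Cons e q)
    then show ?case by (cases q) auto
  qed simp
  with p(2) cas have dist: "distinct (map snd p)" by simp
  have succ: "snd (p ! i) = fst (p ! (Suc i mod n))" if "i < n" for i
  proof (cases "Suc i < n")
    case True
    then show ?thesis using pcas_chain[OF cas] by (simp add: n_def)
  next
    case False
    then have "Suc i = n" using that by simp
    then have "i = length p - 1" "Suc i mod n = 0" by (auto simp: n_def)
    then show ?thesis using pcas_chain[OF cas] n by (auto simp: n_def)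
  qed
  have arc: "p ! i \<in> parcs G" if "i < n" for i
  proof -
    have "set p \<subseteq> parcs G" using p(1) by (simp add: awalk_def)
    moreover have "p ! i \<in> set p" using that by (simp add: n_def)
    ultimately show ?thesis by blast
  qed
  have top: "y = f x" if "(y, x) \<in> parcs G" "lev y \<le> lev x" for x y
    using that(1) by (cases rule: arc_cases) (use that(2) in simp_all)
  define M where "M = Max ((\<lambda>i. lev (snd (p ! i))) ` {..<n})"
  have "M \<in> (\<lambda>i. lev (snd (p ! i))) ` {..<n}"
  proof -
    have "0 \<in> {..<n}" using n by simp
    then have "{..<n} \<noteq> {}" by blast
    then show ?thesis unfolding M_def by (intro Max_in) simp_all
  qed
  then obtain i where i: "i < n" "lev (snd (p ! i)) = M" by blast
  have max: "lev (snd (p ! k)) \<le> M" if "k < n" for k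
    unfolding M_def using that by (intro Max_ge) auto
  define x where "x = snd (p ! i)"
  define j where "j = Suc i mod n"
  \<comment> \<open>\<open>k\<close> and \<open>j\<close> are the cyclic neighbours of
    \<open>i\<close>; adding \<open>n\<close> first keeps the subtraction from truncating at
    \<open>i = 0\<close>. Arcs \<open>i\<close> and \<open>j\<close> meet in \<open>x\<close>, and
    arc \<open>k\<close> ends where arc \<open>i\<close> starts.\<close>
  define k where "k = (i + n - 1) mod n"
  have jk: "j < n" "k < n" using n by (auto simp: j_def k_def)
  have ki: "Suc k mod n = i"
  proof -
    have "Suc k mod n = Suc (i + n - 1) mod n" unfolding k_def by (rule mod_Suc_eq)
    also have "Suc (i + n - 1) = i + n" using n by simp
    finally show ?thesis using i(1) by simp
  qed
  have xj: "fst (p ! j) = x" using succ[OF i(1)] by (simp add: x_def j_def)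
  have pk: "snd (p ! k) = fst (p ! i)" using succ[OF jk(2)] ki by simp
  then have "lev (fst (p ! i)) \<le> lev x" using max[OF jk(2)] i(2) by (simp add: x_def)
  moreover have "(fst (p ! i), x) \<in> parcs G" using arc[OF i(1)] by (simp add: x_def)
  ultimately have fi: "fst (p ! i) = f x" by (rule top[rotated])
  have "lev (snd (p ! j)) \<le> lev x" using max[OF jk(1)] i(2) by (simp add: x_def)
  moreover have "(snd (p ! j), x) \<in> parcs G"
    using arcs_symmetric arc[OF jk(1)] xj by (metis prod.collapse)
  ultimately have "snd (p ! j) = f x" by (rule top[rotated])
  then have "snd (p ! j) = snd (p ! k)" using pk fi by simp
  moreover have "snd (p ! m) = map snd p ! m" if "m < n" for m using that by (simp add: n_def)
  ultimately have "map snd p ! j = map snd p ! k" using jk by simp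
  \<comment> \<open>The heads of the arcs of a cycle are distinct. But \<open>j\<close> is two
    cyclic steps after \<open>k\<close>, so equality forces \<open>n\<close> to divide 2.\<close>
  then have "j = k" using nth_eq_iff_index_eq[OF dist] jk by (simp add: n_def)
  then have "Suc (Suc i mod n) mod n = i" using ki by (simp only: j_def)
  then have "(i + 2) mod n = i" by (simp only: mod_Suc_eq add_2_eq_Suc')
  then have "(i + 2) mod n = i mod n" using i(1) by simp
  then have "n dvd (i + 2) - i" using mod_eq_dvd_iff_nat[of i "i + 2" n] by (simp only: le_add1)
  then have "n dvd 2" by simp
  then have "n \<le> 2" by (rule dvd_imp_le) simp
  with n show False by simp
qed

sublocale rooted_tree_graph G r
proof
  show "Digraph_Component.connected (with_proj G)" by (rule connected_G)
  show "\<not> (\<exists>p. cycle p \<and> 3 \<le> length p)" by (rule no_long_cycle)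
  show "r \<in> pverts G" "0 \<notin> pverts G" using rV V0 by simp_all
qed

lemma parent_map_tree: "parent_map (r, G) = f"
proof
  fix x
  show "par x = f x"
  proof (cases "x \<in> V \<and> x \<noteq> r")
    case True
    then have x: "x \<in> pverts G" "x \<noteq> r" by simp_all
    note p = par_props[OF x, unfolded pverts_G]
    from p(1) show ?thesis
    proof (cases rule: arc_cases)
      \<comment> \<open>Here \<open>x\<close> would be the parent of \<open>par x\<close>, against
        the choice of \<open>par x\<close> as nearer to the root.\<close>
      case 2
      with graph_dist_lev[of x] graph_dist_lev[of "par x"] p True show ?thesis by simp
    qed simp
  next
    case False
    then have "x \<notin> V \<or> x = r" by blast
    then show ?thesis
    proof
      assume "x \<notin> V"
      then show ?thesis using out[of x] par_out[of x] by simp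
    next
      assume "x = r"
      then show ?thesis using root[OF rV] par_root by simp
    qed
  qed
qed

lemma is_rooted_tree_G: "is_rooted_tree (r, G)"
  unfolding is_rooted_tree_def undirected_tree_def
  using connected_G no_long_cycle rV pair_graph by simp

end

lemma rooted_tree_graph_iff:
  "rooted_tree_graph G r \<longleftrightarrow> is_rooted_tree (r, G) \<and> 0 \<notin> pverts G"
  unfolding is_rooted_tree_def undirected_tree_def rooted_tree_graph_def rooted_tree_graph_axioms_def
  by auto

section \<open>Stochastic order of the heights\<close>

definition degree_maps :: "nat list \<Rightarrow> enat \<Rightarrow> (nat \<Rightarrow> nat) set" where
  "degree_maps d T = parent_maps {1..length d} (\<lambda>i. d ! (i - 1)) T"

lemma sum_nth_shift: "(\<Sum>i\<in>{1..length d}. d ! (i - 1)) = sum_list d"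
proof -
  have "(\<Sum>i\<in>{1..length d}. d ! (i - 1)) = (\<Sum>i\<in>{0..<length d}. d ! i)"
    by (rule sum.reindex_bij_witness[of _ Suc "\<lambda>i. i - 1"]) auto
  then show ?thesis by (simp add: sum_list_sum_nth)
qed

lemma trees_of_rooted_tree_graph:
  assumes "(r, G) \<in> trees_of d"
  shows "rooted_tree_graph G r" "pverts G = {1..length d}"
  using assms by (auto simp: trees_of_def rooted_tree_graph_iff)

lemma parent_map_in_degree_maps:
  assumes "(r, G) \<in> trees_of d"
  shows "parent_map (r, G) \<in> degree_maps d \<infinity>"
proof -
  interpret rooted_tree_graph G r by (rule trees_of_rooted_tree_graph[OF assms])
  have V: "pverts G = {1..length d}" by (rule trees_of_rooted_tree_graph[OF assms])
  have ch: "card {w \<in> pverts G. par w = i} = d ! (i - 1)" if "i \<in> pverts G" for i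
    using assms that unfolding children_eq[OF that, symmetric] by (simp add: trees_of_def V)
  have rng: "par w \<in> insert 0 (pverts G)" if "w \<in> pverts G" for w
    using par_props(3)[OF that] by (cases "w = r") simp_all
  have "dep par w < \<infinity>" if "w \<in> pverts G" for w
    by (simp add: dep_par[OF that])
  then show ?thesis
    unfolding degree_maps_def V[symmetric] parent_maps_def using ch rng par_out by blast
qed

text \<open>The parent map determines the arcs by \<open>arcs_eq_par\<close>, and the root as the
  only vertex with value 0.\<close>

lemma parent_map_inj: "inj_on parent_map (trees_of d)"
proof (rule inj_onI)
  fix T T' assume T: "T \<in> trees_of d" "T' \<in> trees_of d" and eq: "parent_map T = parent_map T'"
  obtain r G r' G' where TG: "T = (r, G)" "T' = (r', G')" by (cases T, cases T')
  note G = trees_of_rooted_tree_graph[OF T(1)[unfolded TG]]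
  note G' = trees_of_rooted_tree_graph[OF T(2)[unfolded TG]]
  have "parcs G = parcs G'"
    unfolding rooted_tree_graph.arcs_eq_par[OF G(1)] rooted_tree_graph.arcs_eq_par[OF G'(1)]
    using eq unfolding TG by (simp only:)
  then have "G = G'" using G(2) G'(2) by (cases G; cases G') simp
  moreover have "r = r'"
  proof -
    have "r \<in> pverts G'" using rooted_tree_graph.root_in[OF G(1)] G(2) G'(2) by simp
    moreover have "parent_map (r', G') r = 0"
      using rooted_tree_graph.par_root[OF G(1)] eq unfolding TG by simp
    ultimately show ?thesis using rooted_tree_graph.par_eq_0_iff[OF G'(1)] by blast
  qed
  ultimately show "T = T'" by (simp add: TG)
qed

text \<open>Sorting the vertices by parent, \<open>sum_list d = length d - 1\<close> of them have a
  parent in the vertex set, which leaves exactly one with parent 0.\<close>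

lemma degree_maps_root:
  assumes d: "degree_sequence d" and f: "f \<in> degree_maps d \<infinity>"
  obtains r where "r \<in> {1..length d}" "\<And>x. x \<in> {1..length d} \<Longrightarrow> f x = 0 \<longleftrightarrow> x = r"
proof -
  let ?V = "{1..length d}"
  have rng: "\<And>w. w \<in> ?V \<Longrightarrow> f w \<in> insert 0 ?V"
    and ch: "\<And>i. i \<in> ?V \<Longrightarrow> card {w \<in> ?V. f w = i} = d ! (i - 1)"
    using f unfolding degree_maps_def parent_maps_def by blast+
  have im: "f ` ?V \<subseteq> insert 0 ?V" by (rule image_subsetI) (rule rng)
  have "(\<Sum>i\<in>insert 0 ?V. card {w \<in> ?V. f w = i}) = card ?V"
    unfolding card_eq_sum by (rule sum.group[OF _ _ im]) (rule finite_insert[THEN iffD2] finite_atLeastAtMost)+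
  moreover have "(\<Sum>i\<in>insert 0 ?V. card {w \<in> ?V. f w = i})
      = card {w \<in> ?V. f w = 0} + (\<Sum>i\<in>?V. card {w \<in> ?V. f w = i})"
    by (rule sum.insert) (rule finite_atLeastAtMost, simp)
  moreover have "(\<Sum>i\<in>?V. card {w \<in> ?V. f w = i}) = sum_list d"
    unfolding sum_nth_shift[symmetric] by (intro sum.cong refl ch)
  ultimately have "card {w \<in> ?V. f w = 0} = 1"
    using d card_atLeastAtMost[of 1 "length d"] unfolding degree_sequence_def by linarith
  then obtain r where "{w \<in> ?V. f w = 0} = {r}" by (rule card_1_singletonE)
  then have r: "x \<in> {w \<in> ?V. f w = 0} \<longleftrightarrow> x = r" for x by (simp only: singleton_iff)
  show ?thesis
  proof (rule that)
    show "r \<in> ?V" using r[of r] by blast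
    show "f x = 0 \<longleftrightarrow> x = r" if "x \<in> ?V" for x using r[of x] that by simp
  qed
qed

lemma degree_maps_surj:
  assumes d: "degree_sequence d" and f: "f \<in> degree_maps d \<infinity>"
  shows "f \<in> parent_map ` trees_of d"
proof -
  let ?V = "{1..length d}"
  obtain r where r: "r \<in> ?V" "\<And>x. x \<in> ?V \<Longrightarrow> f x = 0 \<longleftrightarrow> x = r"
    using degree_maps_root[OF d f] by blast
  have rng: "\<And>w. w \<in> ?V \<Longrightarrow> f w \<in> insert 0 ?V" and out: "\<And>w. w \<notin> ?V \<Longrightarrow> f w = 0"
    and ch_f: "\<And>i. i \<in> ?V \<Longrightarrow> card {w \<in> ?V. f w = i} = d ! (i - 1)"
    and dep_f: "\<And>w. w \<in> ?V \<Longrightarrow> dep f w < \<infinity>"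
    using f unfolding degree_maps_def parent_maps_def by blast+
  interpret parent_forest ?V f r
  proof
    show "finite ?V" "0 \<notin> ?V" by simp_all
  qed (fact rng out dep_f r)+
  have ch: "card (children (r, G) i) = d ! (i - 1)" if "i \<in> ?V" for i
  proof -
    have "children (r, G) i = {w \<in> ?V. f w = i}"
      using children_eq[of i, unfolded pverts_G parent_map_tree, OF that] .
    then show ?thesis by (simp only: ch_f[OF that])
  qed
  have "(r, G) \<in> trees_of d"
    unfolding trees_of_def mem_Collect_eq snd_conv using is_rooted_tree_G pverts_G ch by blast
  then show ?thesis using parent_map_tree by (metis imageI)
qed

lemma bij_parent_map:
  "degree_sequence d \<Longrightarrow> bij_betw parent_map (trees_of d) (degree_maps d \<infinity>)"
  unfolding bij_betw_def using parent_map_inj degree_maps_surj parent_map_in_degree_maps by fast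

text \<open>The bound is \<open>t + 2\<close> because \<open>dep\<close> is the distance plus 1 and
  the inequality in \<open>parent_maps\<close> is strict.\<close>

lemma tree_height_le_iff:
  assumes T: "T \<in> trees_of d"
  shows "tree_height T \<le> t \<longleftrightarrow> parent_map T \<in> degree_maps d (enat (t + 2))"
proof -
  obtain r G where TG: "T = (r, G)" by (cases T)
  interpret rooted_tree_graph G r by (rule trees_of_rooted_tree_graph[OF T[unfolded TG]])
  have V: "pverts G = {1..length d}" by (rule trees_of_rooted_tree_graph[OF T[unfolded TG]])
  have "tree_height T \<le> t \<longleftrightarrow> (\<forall>w\<in>pverts G. gd w \<le> t)"
    unfolding tree_height_def TG using root_in V by (subst Max_le_iff) auto
  also have "\<dots> \<longleftrightarrow> (\<forall>w\<in>pverts G. dep par w < enat (t + 2))"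
    by (simp add: dep_par less_Suc_eq_le)
  also have "\<dots> \<longleftrightarrow> par \<in> degree_maps d (enat (t + 2))"
    using parent_map_in_degree_maps[OF T[unfolded TG]]
    unfolding degree_maps_def parent_maps_def V by blast
  finally show ?thesis by (simp add: TG)
qed

lemma degree_maps_mono: "degree_maps d T \<subseteq> degree_maps d \<infinity>"
proof -
  have "x < \<infinity>" if "x < T" for x using that by (cases x) auto
  then show ?thesis unfolding degree_maps_def parent_maps_def by blast
qed

lemma finite_degree_maps: "finite (degree_maps d T)"
  unfolding degree_maps_def by (rule finite_parent_maps) simp

lemma prob_height_le:
  assumes d: "degree_sequence d" and ne: "degree_maps d \<infinity> \<noteq> {}"
  shows "measure (measure_pmf (uniform_tree d)) {T. tree_height T \<le> t} =
    card (degree_maps d (enat (t + 2))) / card (degree_maps d \<infinity>)"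
proof -
  note bij = bij_parent_map[OF d]
  have "trees_of d \<noteq> {}" using bij ne by (auto simp: bij_betw_def)
  then have "measure (measure_pmf (uniform_tree d)) {T. tree_height T \<le> t} =
      card (trees_of d \<inter> {T. tree_height T \<le> t}) / card (trees_of d)"
    unfolding uniform_tree_def by (rule measure_pmf_of_set[OF _ finite_trees_of])
  moreover have "card (trees_of d) = card (degree_maps d \<infinity>)" using bij by (rule bij_betw_same_card)
  moreover have "bij_betw parent_map (trees_of d \<inter> {T. tree_height T \<le> t}) (degree_maps d (enat (t + 2)))"
  proof (rule bij_betw_subset[OF bij])
    show "parent_map ` (trees_of d \<inter> {T. tree_height T \<le> t}) = degree_maps d (enat (t + 2))"
    proof (intro equalityI subsetI)
      fix f assume f: "f \<in> degree_maps d (enat (t + 2))"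
      then have "f \<in> parent_map ` trees_of d" using degree_maps_mono degree_maps_surj[OF d] by blast
      then obtain T where T: "T \<in> trees_of d" "f = parent_map T" by blast
      with f tree_height_le_iff[OF T(1)] show "f \<in> parent_map ` (trees_of d \<inter> {T. tree_height T \<le> t})"
        by blast
    next
      fix f assume "f \<in> parent_map ` (trees_of d \<inter> {T. tree_height T \<le> t})"
      then obtain T where "T \<in> trees_of d" "tree_height T \<le> t" "f = parent_map T" by blast
      then show "f \<in> degree_maps d (enat (t + 2))" using tree_height_le_iff by blast
    qed
  qed blast
  ultimately show ?thesis by (simp add: bij_betw_same_card)
qed

text \<open>Cross-multiplied form of the stochastic order of the heights, for parent maps.\<close>

definition taller :: "nat list \<Rightarrow> nat list \<Rightarrow> bool" where
  "taller b d \<longleftrightarrow> (\<forall>T. card (degree_maps b T) * card (degree_maps d \<infinity>)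
                   \<le> card (degree_maps d T) * card (degree_maps b \<infinity>))"

lemma taller_refl: "taller d d"
  by (simp add: taller_def)

lemma taller_trans:
  assumes "taller c b" "taller b d" and pos: "card (degree_maps b \<infinity>) > 0"
  shows "taller c d"
  unfolding taller_def
proof
  fix T
  let ?n = "\<lambda>d. card (degree_maps d T)" and ?N = "\<lambda>d. card (degree_maps d \<infinity>)"
  have "?N b * (?n c * ?N d) = (?n c * ?N b) * ?N d" by simp
  also have "\<dots> \<le> (?n b * ?N c) * ?N d" using assms(1) by (auto simp: taller_def)
  also have "\<dots> = (?n b * ?N d) * ?N c" by simp
  also have "\<dots> \<le> (?n d * ?N b) * ?N c" using assms(2) unfolding taller_def by (intro mult_right_mono) auto
  also have "\<dots> = ?N b * (?n d * ?N c)" by simp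
  finally show "?n c * ?N d \<le> ?n d * ?N c" using pos by simp
qed

lemma stoch_le_height:
  assumes d: "degree_sequence d" "card (degree_maps d \<infinity>) > 0"
    and b: "degree_sequence b" "card (degree_maps b \<infinity>) > 0" and tall: "taller b d"
  shows "stoch_le (measure_pmf (uniform_tree d)) (\<lambda>T. real (tree_height T))
           (measure_pmf (uniform_tree b)) (\<lambda>T. real (tree_height T))"
  unfolding stoch_le_def
proof
  fix t :: real
  show "measure (measure_pmf (uniform_tree b)) {y \<in> space (measure_pmf (uniform_tree b)). real (tree_height y) \<le> t}
      \<le> measure (measure_pmf (uniform_tree d)) {x \<in> space (measure_pmf (uniform_tree d)). real (tree_height x) \<le> t}"
  proof (cases "t < 0")
    case True
    then have "\<not> real (tree_height y) \<le> t" for y :: "nat rooted_tree"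
      using of_nat_0_le_iff[of "tree_height y", where 'a = real] by linarith
    then show ?thesis by simp
  next
    case False
    \<comment> \<open>Heights are integers, so a real threshold may be rounded down; for negative
      \<open>t\<close> both events were empty.\<close>
    define k where "k = nat \<lfloor>t\<rfloor>"
    have k: "real (tree_height y) \<le> t \<longleftrightarrow> tree_height y \<le> k" for y :: "nat rooted_tree"
      using False by (simp add: k_def le_nat_iff le_floor_iff)
    let ?n = "\<lambda>d. card (degree_maps d (enat (k + 2)))" and ?N = "\<lambda>d. card (degree_maps d \<infinity>)"
    have "?n b * ?N d \<le> ?n d * ?N b" using tall by (simp add: taller_def)
    then have "real (?n b) * real (?N d) \<le> real (?n d) * real (?N b)"
      by (simp only: of_nat_mult[symmetric] of_nat_le_iff)
    then have "real (?n b) / real (?N b) \<le> real (?n d) / real (?N d)"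
      using b(2) d(2) by (simp add: divide_simps)
    moreover have "degree_maps b \<infinity> \<noteq> {}" "degree_maps d \<infinity> \<noteq> {}" using b(2) d(2) by auto
    ultimately show ?thesis
      by (simp add: k prob_height_le[OF b(1)] prob_height_le[OF d(1)])
  qed
qed

section \<open>The two moves on degree sequences: transferring a child and appending a 1\<close>

lemma card_degree_maps_transfer:
  assumes ij: "i < length d" "j < length d" "d ! j < d ! i"
  defines "d' \<equiv> d[i := d ! i - 1, j := d ! j + 1]"
  shows "(d ! j + 1) * card (degree_maps d' T) \<le> d ! i * card (degree_maps d T)"
    and "(d ! j + 1) * card (degree_maps d' \<infinity>) = d ! i * card (degree_maps d \<infinity>)"
proof -
  define \<delta> where "\<delta> = (\<lambda>x. d ! (x - 1))"
  have ne: "i \<noteq> j" using ij by auto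
  have V: "finite {1..length d}" "0 \<notin> {1..length d}" "Suc i \<in> {1..length d}" "Suc j \<in> {1..length d}"
    "Suc i \<noteq> Suc j" and lt: "\<delta> (Suc j) < \<delta> (Suc i)"
    using ij ne by (auto simp: \<delta>_def)
  have d': "degree_maps d' T =
      parent_maps {1..length d} (\<delta>(Suc i := \<delta> (Suc i) - 1, Suc j := \<delta> (Suc j) + 1)) T" for T
    unfolding degree_maps_def d'_def length_list_update
    using ij ne by (intro parent_maps_cong) (auto simp: \<delta>_def nth_list_update)
  have d: "degree_maps d T = parent_maps {1..length d} \<delta> T" for T
    by (simp add: degree_maps_def \<delta>_def)
  show "(d ! j + 1) * card (degree_maps d' T) \<le> d ! i * card (degree_maps d T)"
    "(d ! j + 1) * card (degree_maps d' \<infinity>) = d ! i * card (degree_maps d \<infinity>)"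
    using card_parent_maps_transfer[where \<delta> = \<delta>, OF V lt]
    unfolding d d' by (simp_all add: \<delta>_def)
qed

text \<open>The bounded inequality and the unbounded equality carry the same factors
  \<open>d ! j + 1\<close> and \<open>d ! i\<close>, so these cancel in the ratio.\<close>

lemma taller_transfer:
  assumes ij: "i < length d" "j < length d" "d ! j < d ! i"
  shows "taller (d[i := d ! i - 1, j := d ! j + 1]) d"
  unfolding taller_def
proof
  fix T
  let ?d' = "d[i := d ! i - 1, j := d ! j + 1]"
  note tr = card_degree_maps_transfer[OF ij]
  have "(d ! j + 1) * (card (degree_maps ?d' T) * card (degree_maps d \<infinity>))
      = ((d ! j + 1) * card (degree_maps ?d' T)) * card (degree_maps d \<infinity>)" by (simp only: mult.assoc)
  also have "\<dots> \<le> (d ! i * card (degree_maps d T)) * card (degree_maps d \<infinity>)"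
    using tr(1) by (rule mult_right_mono) simp
  also have "\<dots> = card (degree_maps d T) * (d ! i * card (degree_maps d \<infinity>))" by (simp only: ac_simps)
  also have "\<dots> = (d ! j + 1) * (card (degree_maps d T) * card (degree_maps ?d' \<infinity>))"
    unfolding tr(2)[symmetric] by (simp only: ac_simps)
  finally show "card (degree_maps ?d' T) * card (degree_maps d \<infinity>)
      \<le> card (degree_maps d T) * card (degree_maps ?d' \<infinity>)"
    by (subst (asm) mult_le_cancel1) simp
qed

lemma degree_maps_snoc:
  "degree_maps (d @ [1]) T =
    parent_maps (insert (Suc (length d)) {1..length d}) ((\<lambda>i. d ! (i - 1))(Suc (length d) := 1)) T"
proof -
  have "{1..length (d @ [1])} = insert (Suc (length d)) {1..length d}" by auto
  then show ?thesis
    unfolding degree_maps_def by (simp only:) (rule parent_maps_cong, auto simp: nth_append)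
qed

text \<open>Inserting the new vertex multiplies the number of all trees by exactly
  \<open>length d\<close>, and the number of those within a height bound by at most that.\<close>

lemma taller_snoc: "taller (d @ [1]) d"
  unfolding taller_def
proof
  fix T
  have V: "finite {1..length d}" "0 \<notin> {1..length d}" "Suc (length d) \<notin> {1..length d}"
    "Suc (length d) \<noteq> 0" by auto
  note ins = card_parent_maps_insert[OF V, of "\<lambda>i. d ! (i - 1)"]
  have "card (degree_maps (d @ [1]) T) * card (degree_maps d \<infinity>)
      \<le> card (degree_maps d T) * length d * card (degree_maps d \<infinity>)"
    unfolding degree_maps_snoc using ins(2)[of T] by (simp add: degree_maps_def)
  also have "\<dots> = card (degree_maps d T) * card (degree_maps (d @ [1]) \<infinity>)"
    unfolding degree_maps_snoc using ins(1) by (simp add: degree_maps_def)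
  finally show "card (degree_maps (d @ [1]) T) * card (degree_maps d \<infinity>)
      \<le> card (degree_maps d T) * card (degree_maps (d @ [1]) \<infinity>)" .
qed

lemma sum_list_update2:
  fixes d :: "nat list"
  assumes "i < length d" "j < length d" "i \<noteq> j"
  shows "sum_list (d[i := p, j := q]) + d ! i + d ! j = sum_list d + p + q"
proof -
  have u: "sum_list (xs[k := v]) + xs ! k = sum_list xs + v" if "k < length xs" for xs :: "nat list" and k v
    using that member_le_sum_list[of "xs ! k" xs] by (simp add: sum_list_update nth_mem)
  show ?thesis using u[of i d p] u[of j "d[i := p]" q] assms by simp
qed

section \<open>Every degree sequence is realised by a tree\<close>

lemma star_degree_maps:
  assumes "d \<noteq> []" "d ! 0 + 1 = length d" "\<And>j. 0 < j \<Longrightarrow> j < length d \<Longrightarrow> d ! j = 0"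
  shows "(\<lambda>w. if w \<in> {2..length d} then 1 else 0) \<in> degree_maps d \<infinity>"
proof -
  define f :: "nat \<Rightarrow> nat" where "f = (\<lambda>w. if w \<in> {2..length d} then 1 else 0)"
  have n: "1 \<le> length d" using assms(1) by (cases d) auto
  have dep1: "dep f 1 < \<infinity>" 
  proof -
    have "f 1 = 0" by (simp add: f_def)
    then show ?thesis using dep_step[of 1 f] by (simp add: zero_enat_def eSuc_enat)
  qed
  have "dep f w < \<infinity>" if "w \<in> {1..length d}" for w
  proof (cases "w = 1")
    case False
    then have "w \<noteq> 0" "f w = 1" using that by (auto simp: f_def)
    then show ?thesis using dep_step[of w f] dep1 by (cases "dep f 1") (auto simp: eSuc_enat)
  qed (use dep1 in simp)
  moreover have "card {w \<in> {1..length d}. f w = i} = d ! (i - 1)" if i: "i \<in> {1..length d}" for i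
  proof (cases "i = 1")
    case True
    have "{w \<in> {1..length d}. f w = 1} = {2..length d}" by (auto simp: f_def)
    then show ?thesis using assms(2) True by simp
  next
    case False
    then have "{w \<in> {1..length d}. f w = i} = {}" using i by (auto simp: f_def)
    then have "card {w \<in> {1..length d}. f w = i} = 0" by (simp only: card.empty)
    moreover have "d ! (i - 1) = 0" using assms(3)[of "i - 1"] False i by auto
    ultimately show ?thesis by (simp only:)
  qed
  moreover have "f w \<in> insert 0 {1..length d}" "w \<notin> {1..length d} \<Longrightarrow> f w = 0" for w
    using n by (auto simp: f_def)
  ultimately have "f \<in> degree_maps d \<infinity>"
    unfolding degree_maps_def parent_maps_def by blast
  then show ?thesis by (simp only: f_def)
qed

text \<open>Children are moved one at a time to the first vertex until the tree is a star. The exact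
  transfer identity has positive factors, so positivity of the count passes back through each
  move.\<close>

lemma card_degree_maps_pos:
  assumes "degree_sequence d"
  shows "card (degree_maps d \<infinity>) > 0"
  using assms
proof (induction "length d - d ! 0" arbitrary: d rule: less_induct)
  case less
  have d: "sum_list d + 1 = length d" using less.prems by (simp add: degree_sequence_def)
  then have ne: "0 < length d" by linarith
  show ?case
  proof (cases "\<exists>j. 0 < j \<and> j < length d \<and> d ! j \<noteq> 0")
    case False
    then have z: "d ! j = 0" if "0 < j" "j < length d" for j using that by blast
    obtain x xs where xs: "d = x # xs" using ne by (cases d) auto
    have "\<forall>y\<in>set xs. y = 0"
      using z[of "Suc _"] by (auto simp: xs in_set_conv_nth)
    then have "sum_list xs = 0" by simp
    moreover have "sum_list d = d ! 0 + sum_list xs" by (simp add: xs)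
    ultimately have "d ! 0 + 1 = length d" using d by linarith
    \<comment> \<open>All children belong to vertex 1, so the star with that root is a
      witness.\<close>
    then have "degree_maps d \<infinity> \<noteq> {}" using star_degree_maps[of d] z ne by auto
    then show ?thesis using finite_degree_maps by (simp add: card_gt_0_iff)
  next
    case True
    then obtain j where j: "0 < j" "j < length d" "0 < d ! j" by auto
    define d' where "d' = d[j := d ! j - 1, 0 := d ! 0 + 1]"
    have len: "length d' = length d" by (simp add: d'_def)
    have nth: "d' ! 0 = d ! 0 + 1" "d' ! j = d ! j - 1"
      using j ne by (simp_all add: d'_def nth_list_update)
    have sum: "sum_list d' = sum_list d"
      using sum_list_update2[of j d 0 "d ! j - 1" "d ! 0 + 1"] j ne by (simp add: d'_def)
    have "degree_sequence d'" using d sum len by (simp add: degree_sequence_def)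
    moreover have "length d' - d' ! 0 < length d - d ! 0"
    proof -
      have "d ! 0 \<le> sum_list d" using ne by (intro member_le_sum_list) auto
      then show ?thesis using d len nth by simp
    qed
    ultimately have pos: "card (degree_maps d' \<infinity>) > 0" using less.hyps by blast
    show ?thesis
    proof (cases "d ! 0 < d ! j")
      case True
      have eq: "(d ! 0 + 1) * card (degree_maps d' \<infinity>) = d ! j * card (degree_maps d \<infinity>)"
        unfolding d'_def by (rule card_degree_maps_transfer(2)) (use j True in auto)
      have "0 < (d ! 0 + 1) * card (degree_maps d' \<infinity>)" using pos by simp
      then have "0 < d ! j * card (degree_maps d \<infinity>)" by (simp only: eq)
      then show ?thesis by (simp only: nat_0_less_mult_iff)
    next
      case False
      \<comment> \<open>The identity requires the donor to have the larger degree. When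
        \<open>d ! j \<le> d ! 0\<close> it is therefore applied to the reverse move, from vertex 0
        back to \<open>j\<close> in \<open>d'\<close>.\<close>
      have restore: "d'[0 := d' ! 0 - 1, j := d' ! j + 1] = d"
      proof (rule nth_equalityI)
        fix k assume "k < length (d'[0 := d' ! 0 - 1, j := d' ! j + 1])"
        then have "k < length d" by (simp add: len)
        then show "d'[0 := d' ! 0 - 1, j := d' ! j + 1] ! k = d ! k"
          unfolding nth using j ne by (cases "k = j"; cases "k = 0") (simp_all add: d'_def)
      qed (simp add: len)
      have "(d' ! j + 1) * card (degree_maps (d'[0 := d' ! 0 - 1, j := d' ! j + 1]) \<infinity>)
          = d' ! 0 * card (degree_maps d' \<infinity>)"
        by (rule card_degree_maps_transfer(2)) (use j False nth len in auto)
      then have "(d' ! j + 1) * card (degree_maps d \<infinity>) = d' ! 0 * card (degree_maps d' \<infinity>)"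
        unfolding restore .
      moreover have "0 < d' ! 0 * card (degree_maps d' \<infinity>)" using pos nth(1) by simp
      ultimately have "0 < (d' ! j + 1) * card (degree_maps d \<infinity>)" by (simp only:)
      then show ?thesis by (simp only: nat_0_less_mult_iff)
    qed
  qed
qed

section \<open>Reduction to a sub-binary sequence\<close>

lemma num_degree_eq_count: "num_degree i d = count (mset d) i"
proof -
  have "bij_betw Suc {j. j < length d \<and> d ! j = i} {j \<in> {1..length d}. d ! (j - 1) = i}"
    by (rule bij_betw_byWitness[where f' = "\<lambda>j. j - 1"]) auto
  then have "num_degree i d = card {j. j < length d \<and> d ! j = i}"
    unfolding num_degree_def by (rule bij_betw_same_card[symmetric])
  also have "\<dots> = length (filter (\<lambda>x. x = i) d)" by (rule length_filter_conv_card[symmetric])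
  also have "\<dots> = count (mset d) i" by (induction d) auto
  finally show ?thesis .
qed

lemma sub_binary_iff: "sub_binary d \<longleftrightarrow> (\<forall>x\<in>set d. x \<le> 2)"
proof -
  have "sub_binary d \<longleftrightarrow> (\<forall>i\<ge>3. i \<notin> set d)"
    by (simp add: sub_binary_def num_degree_eq_count count_eq_zero_iff)
  also have "\<dots> \<longleftrightarrow> (\<forall>x\<in>set d. x \<le> 2)"
  proof -
    have "3 \<le> x \<longleftrightarrow> \<not> x \<le> 2" for x :: nat by linarith
    then show ?thesis by blast
  qed
  finally show ?thesis .
qed

lemma mset_update2:
  fixes d :: "nat list"
  assumes "i < length d" "j < length d" "i \<noteq> j"
  obtains M where "mset d = {#d ! i, d ! j#} + M" "mset (d[i := p, j := q]) = {#p, q#} + M"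
proof -
  have 1: "d ! i \<in># mset d" using assms by simp
  have 2: "mset (d[i := p]) = add_mset p (mset d - {#d ! i#})" using assms by (simp add: mset_update)
  have "d ! j \<in># mset d - {#d ! i#}"
  proof -
    \<comment> \<open>Overwriting position \<open>i\<close> by a value other than
      \<open>d ! j\<close> shows that the occurrence at \<open>j\<close> survives the removal of
      \<open>d ! i\<close>, even if the two entries are equal.\<close>
    have "count (mset (d[i := d ! j + 1])) (d ! j) = count (mset d - {#d ! i#}) (d ! j)"
      using assms by (simp add: mset_update)
    moreover have "d ! j \<in> set (d[i := d ! j + 1])"
      using assms by (metis length_list_update nth_list_update_neq nth_mem)
    ultimately show ?thesis by (metis count_mset_0_iff count_eq_zero_iff)
  qed
  then obtain M where M: "mset d - {#d ! i#} = add_mset (d ! j) M" by (metis insert_DiffM)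
  have "mset d = {#d ! i, d ! j#} + M" using 1 M by (metis add_mset_add_single insert_DiffM union_mset_add_mset_left add_0)
  moreover have "mset (d[i := p, j := q]) = {#p, q#} + M"
    using assms by (simp add: mset_update 2 M)
  ultimately show ?thesis by (rule that)
qed

text \<open>
  A vertex of degree \<open>a \<ge> 3\<close> gives one child to a vertex of degree 1 if there is one, and to a
  leaf otherwise, so that the number of vertices of degree 1 never exceeds \<open>max 1 n\<^sub>1\<close>.
\<close>

lemma sub_binary_taller:
  assumes "degree_sequence d"
  shows "\<exists>b. degree_sequence b \<and> sub_binary b \<and> length b = length d \<and>
           num_degree 1 b \<le> max 1 (num_degree 1 d) \<and> taller b d"
  using assms
\<comment> \<open>The measure is the total excess of the degrees over 2. Each move lowers it by 1 at
  the donor, and the receiver ends with degree at most 2, hence adds nothing.\<close>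
proof (induction "sum_mset (image_mset (\<lambda>x. x - 2) (mset d))" arbitrary: d rule: less_induct)
  case less
  show ?case
  proof (cases "sub_binary d")
    case True
    then show ?thesis using less.prems taller_refl by (intro exI[of _ d]) simp
  next
    case False
    then obtain i where i: "i < length d" "3 \<le> d ! i"
      by (auto simp: sub_binary_iff in_set_conv_nth not_le)
    have d: "sum_list d + 1 = length d" using less.prems by (simp add: degree_sequence_def)
    have "0 \<in> set d"
    proof (rule ccontr)
      assume "0 \<notin> set d"
      then have "\<forall>x\<in>set d. 1 \<le> x" by (auto simp: Suc_le_eq intro: gr0I)
      then have "length d \<le> sum_list d" by (induction d) auto
      with d show False by simp
    qed
    obtain j where j: "j < length d" "d ! j \<le> 1" "d ! j = 0 \<Longrightarrow> num_degree 1 d = 0"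
    proof (cases "1 \<in> set d")
      case True
      then obtain j where "j < length d" "d ! j = 1" by (auto simp: in_set_conv_nth)
      then show ?thesis by (intro that[of j]) auto
    next
      case False
      then have "num_degree 1 d = 0" by (simp add: num_degree_eq_count count_eq_zero_iff)
      moreover obtain j where "j < length d" "d ! j = 0"
        using \<open>0 \<in> set d\<close> by (auto simp: in_set_conv_nth)
      ultimately show ?thesis by (intro that[of j]) auto
    qed
    define d' where "d' = d[i := d ! i - 1, j := d ! j + 1]"
    have ij: "i \<noteq> j" "d ! j < d ! i" using i j by auto
    have tall: "taller d' d" unfolding d'_def using taller_transfer i j ij by blast
    obtain M where M: "mset d = {#d ! i, d ! j#} + M" "mset d' = {#d ! i - 1, d ! j + 1#} + M"
      unfolding d'_def using mset_update2[OF i(1) j(1) ij(1)] by blast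
    have len: "length d' = length d" by (simp add: d'_def)
    have "sum_list d' = sum_list d"
      using sum_list_update2[OF i(1) j(1) ij(1), of "d ! i - 1" "d ! j + 1"] i by (simp add: d'_def)
    then have d': "degree_sequence d'" using d len by (simp add: degree_sequence_def)
    have "sum_mset (image_mset (\<lambda>x. x - 2) (mset d')) < sum_mset (image_mset (\<lambda>x. x - 2) (mset d))"
      unfolding M using i j by simp
    then obtain b where b: "degree_sequence b" "sub_binary b" "length b = length d'"
      "num_degree 1 b \<le> max 1 (num_degree 1 d')" "taller b d'"
      using less.hyps d' by blast
    \<comment> \<open>The donor keeps degree at least 2. A receiver of degree 1 leaves the count,
      and a leaf receives only when the count was 0, making it 1.\<close>
    have "num_degree 1 d' \<le> max 1 (num_degree 1 d)"
      using i j unfolding num_degree_eq_count M by (cases "d ! j = 0") auto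
    then have "num_degree 1 b \<le> max 1 (num_degree 1 d)" using b(4) by linarith
    moreover have "taller b d"
      using b(5) tall card_degree_maps_pos[OF d'] by (rule taller_trans)
    ultimately show ?thesis using b len by auto
  qed
qed

text \<open>Degrees 0 and 2 do not affect the parity of the sum. This is what later lowers a bound
  of 1 on the number of ones to 0.\<close>

lemma even_sum_sub_binary:
  assumes "sub_binary b"
  shows "even (sum_list b) \<longleftrightarrow> even (num_degree 1 b)"
proof -
  have "\<forall>x\<in>set b. x \<le> 2" using assms by (simp add: sub_binary_iff)
  then show ?thesis unfolding num_degree_eq_count
  proof (induction b)
    case (Cons x b)
    then have "x = 0 \<or> x = 1 \<or> x = 2" by auto
    with Cons show ?case by auto
  qed simp
qed

theorem corollary12:
  fixes d :: "nat list"
  assumes "degree_sequence d"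
  shows "\<exists>b. degree_sequence b \<and> sub_binary b \<and> length b = n_plus d \<and>
           num_degree 1 b \<le> num_degree 1 d \<and>
           stoch_le (measure_pmf (uniform_tree d)) (\<lambda>T. real (tree_height T))
                    (measure_pmf (uniform_tree b)) (\<lambda>T. real (tree_height T))"
proof -
  \<comment> \<open>The degrees sum to the length minus 1, hence the opposite parities.\<close>
  have parity: "even (num_degree 1 b) \<longleftrightarrow> odd (length b)" if "degree_sequence b" "sub_binary b" for b
    using even_sum_sub_binary[OF that(2)] that(1) unfolding degree_sequence_def by (metis even_add odd_one)
  have "\<exists>b. degree_sequence b \<and> sub_binary b \<and> length b = n_plus d \<and>
          num_degree 1 b \<le> num_degree 1 d \<and> taller b d"
  proof (cases "num_degree 1 d = 0 \<and> even (length d)")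
    case False
    obtain b where b: "degree_sequence b" "sub_binary b" "length b = length d"
      "num_degree 1 b \<le> max 1 (num_degree 1 d)" "taller b d"
      using sub_binary_taller[OF assms] by blast
    have "num_degree 1 b \<le> num_degree 1 d"
    proof (cases "num_degree 1 d = 0")
      case True
      \<comment> \<open>Here \<open>length d\<close> is odd; the reduction allows at most one vertex
        of degree 1, and parity excludes exactly one.\<close>
      then have "even (num_degree 1 b)" "num_degree 1 b \<le> 1" using False parity b by auto
      then have "num_degree 1 b = 0" by (cases "num_degree 1 b = 1") auto
      then show ?thesis by simp
    qed (use b(4) in simp)
    moreover have "n_plus d = length d" using False by (auto simp: n_plus_def)
    ultimately show ?thesis using b by auto
  next
    case True
    \<comment> \<open>The extra 1 makes the length odd, so the same parity argument removes it again
      during the reduction.\<close>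
    have d1: "degree_sequence (d @ [1])" using assms by (simp add: degree_sequence_def)
    have "num_degree 1 (d @ [1]) = 1" using True by (simp add: num_degree_eq_count)
    then obtain b where b: "degree_sequence b" "sub_binary b" "length b = length d + 1"
      "num_degree 1 b \<le> 1" "taller b (d @ [1])"
      using sub_binary_taller[OF d1] by auto
    have "even (num_degree 1 b)" using True parity b by simp
    with b(4) have "num_degree 1 b = 0" by (cases "num_degree 1 b = 1") auto
    moreover have "taller b d"
      using b(5) taller_snoc card_degree_maps_pos[OF d1] by (rule taller_trans)
    moreover have "n_plus d = length d + 1" using True by (simp add: n_plus_def)
    ultimately show ?thesis using b by auto
  qed
  then show ?thesis
    using stoch_le_height[OF assms card_degree_maps_pos[OF assms]] card_degree_maps_pos by blast
qed

end
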